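(* Let $H$ be a countable group with a normal subgroup $F$ that is a free non-abelian group of finite rank. Suppose that $H$ is a semidirect product $H=F\rtimes A$ of $F$ by a subgroup $A\subset H$. Suppose, moreover, that $F$ contains a nontrivial element that is fixed under the action of $A$ on $F$ (by conjugation). Then for each nondegenerate probability measure $\mu$ on $H$ and for almost every path $\tau=\{\tau_i\}_{i\in\mathbb Z_+}=\{x_i\alpha_i\}_{i\in\mathbb Z_+}$ of the random $\mu$-walk on $H$, where $x_i\in F$ and $\alpha_i\in A$, the sequence $\{x_i\}_{i\in\mathbb Z_+}$ of elements of $F$ converges in the hyperbolic compactification $F\cup\partial F$ to a point $w(\tau)$ of the boundary $\partial F$.
   Context: A probability measure $\mu$ on a countable group $H$ is nondegenerate if its support generates $H$ as a semigroup. The random $\mu$-walk on $H$ is the Markov chain $\tau=\{\tau_i\}_{i\ge 0}$ with $\tau_0=e$ and transition probabilities $P(g,h)=\mu(g^{-1}h)$; a realization is called a path, and "almost every path" refers to the associated Markov measure on $H^{\mathbb Z_+}$. For a free group $F$ of finite rank $\ge 2$ with a fixed basis, the hyperbolic compactification $F\cup\partial F$ is identified with the set of all finite (giving $F$) and right-infinite (giving $\partial F$) reduced words in the basis elements and their inverses; its topology is given by the metric $\rho(v,w)=((v|w)+1)^{-1}$ for $v\ne w$, where $(v|w)$ is the length of the longest common prefix of the two words. *)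

theory Defs
  imports "HOL-Probability.Probability" "HOL-Algebra.Coset" "HOL-Library.Sublist"
begin

section \<open>Free bases and the hyperbolic compactification\<close>

text \<open>The letter \<open>(x, True)\<close> stands for the basis element \<open>x\<close> and \<open>(x, False)\<close> for its formal
  inverse; formal signs keep the two apart in any group.\<close>

type_synonym 'a letter = "'a \<times> bool"

definition cancelling :: "'a letter \<Rightarrow> 'a letter \<Rightarrow> bool" where
  "cancelling p q \<longleftrightarrow> fst p = fst q \<and> snd p \<noteq> snd q"

definition reduced_words :: "'a set \<Rightarrow> 'a letter list set" where
  "reduced_words X = {u. fst ` set u \<subseteq> X \<and> successively (\<lambda>p q. \<not> cancelling p q) u}"

definition reduced_rays :: "'a set \<Rightarrow> (nat \<Rightarrow> 'a letter) set" where
  "reduced_rays X = {f. (\<forall>n. fst (f n) \<in> X) \<and> (\<forall>n. \<not> cancelling (f n) (f (Suc n)))}"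

definition letter_value :: "('a, 'b) monoid_scheme \<Rightarrow> 'a letter \<Rightarrow> 'a" where
  "letter_value H p = (if snd p then fst p else inv\<^bsub>H\<^esub> (fst p))"

definition word_value :: "('a, 'b) monoid_scheme \<Rightarrow> 'a letter list \<Rightarrow> 'a" where
  "word_value H u = foldr (\<lambda>p g. letter_value H p \<otimes>\<^bsub>H\<^esub> g) u \<one>\<^bsub>H\<^esub>"

definition free_basis :: "('a, 'b) monoid_scheme \<Rightarrow> 'a set \<Rightarrow> 'a set \<Rightarrow> bool" where
  "free_basis H F X \<longleftrightarrow> X \<subseteq> F \<and> bij_betw (word_value H) (reduced_words X) F"

definition reduced_form :: "('a, 'b) monoid_scheme \<Rightarrow> 'a set \<Rightarrow> 'a \<Rightarrow> 'a letter list" where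
  "reduced_form H X = the_inv_into (reduced_words X) (word_value H)"

datatype 'l fi_word = Fin_word "'l list" | Inf_word "nat \<Rightarrow> 'l"

primrec has_prefix :: "'l fi_word \<Rightarrow> 'l list \<Rightarrow> bool" where
  "has_prefix (Fin_word v) u \<longleftrightarrow> prefix u v"
| "has_prefix (Inf_word f) u \<longleftrightarrow> u = map f [0..<length u]"

text \<open>Only meaningful for distinct words, where the set below is finite.\<close>

definition common_prefix_length :: "'l fi_word \<Rightarrow> 'l fi_word \<Rightarrow> nat" where
  "common_prefix_length v w = Max {length u |u. has_prefix v u \<and> has_prefix w u}"

definition word_dist :: "'l fi_word \<Rightarrow> 'l fi_word \<Rightarrow> real" where
  "word_dist v w = (if v = w then 0 else 1 / (real (common_prefix_length v w) + 1))"

definition hyp_boundary :: "'a set \<Rightarrow> 'a letter fi_word set" where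
  "hyp_boundary X = Inf_word ` reduced_rays X"

definition hyp_compactification :: "'a set \<Rightarrow> 'a letter fi_word set" where
  "hyp_compactification X = Fin_word ` reduced_words X \<union> hyp_boundary X"

definition hyp_topology :: "'a set \<Rightarrow> 'a letter fi_word topology" where
  "hyp_topology X = Metric_space.mtopology (hyp_compactification X) word_dist"

lemma has_prefix_take: "has_prefix w u \<Longrightarrow> has_prefix w (take n u)"
proof (cases w)
  case (Fin_word v)
  then show "has_prefix w u \<Longrightarrow> has_prefix w (take n u)"
    by (auto intro: prefix_order.trans[OF take_is_prefix])
next
  case (Inf_word f)
  assume "has_prefix w u"
  then have "u = map f [0..<length u]" using Inf_word by simp
  then have "take n u = map f (take n [0..<length u])" by (metis take_map)
  also have "\<dots> = map f [0..<length (take n u)]" by (cases "n \<le> length u") auto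
  finally show ?thesis using Inf_word by simp
qed

lemma has_prefix_unique:
  assumes "has_prefix w u" "has_prefix w v" "length u = length v" shows "u = v"
  using assms
proof (cases w)
  case (Fin_word x)
  then show ?thesis using assms by (auto simp: prefix_def append_eq_append_conv)
next
  case (Inf_word f)
  then show ?thesis using assms by (metis has_prefix.simps(2))
qed

lemma has_prefix_ext:
  assumes "\<And>u. has_prefix v u \<longleftrightarrow> has_prefix w u" shows "v = w"
proof -
  have *: False if h: "\<And>u. has_prefix (Fin_word a) u \<longleftrightarrow> has_prefix (Inf_word f) u"
    for a :: "'a list" and f
  proof -
    have "prefix (map f [0..<Suc (length a)]) a" using h[of "map f [0..<Suc (length a)]"] by simp
    then show False by (auto dest: prefix_length_le)
  qed
  show ?thesis
  proof (cases v)
    case v: (Fin_word a)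
    show ?thesis
    proof (cases w)
      case (Fin_word b)
      then show ?thesis using assms[of a] assms[of b] v by (auto intro: prefix_order.antisym)
    next
      case (Inf_word f)
      then show ?thesis using *[of a f] assms v by simp
    qed
  next
    case v: (Inf_word f)
    show ?thesis
    proof (cases w)
      case (Fin_word b)
      then show ?thesis using *[of b f] assms v by simp
    next
      case (Inf_word g)
      have "f n = g n" for n
        using assms[of "map f [0..<Suc n]"] v Inf_word by simp
      then show ?thesis using v Inf_word by auto
    qed
  qed
qed

lemma finite_common_prefix:
  assumes "v \<noteq> w" shows "finite {length u |u. has_prefix v u \<and> has_prefix w u}" (is "finite ?S")
proof -
  obtain u where u: "has_prefix v u \<noteq> has_prefix w u" using assms has_prefix_ext by blast
  have "n < length u" if n: "n \<in> ?S" for n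
  proof (rule ccontr)
    assume "\<not> n < length u"
    then obtain z where z: "has_prefix v z" "has_prefix w z" "length u \<le> length z" using n by auto
    have "has_prefix v (take (length u) z)" "has_prefix w (take (length u) z)"
      using z has_prefix_take by blast+
    then show False using u z(3) has_prefix_unique[of _ u "take (length u) z"]
      by (metis length_take min.absorb2)
  qed
  then show ?thesis by (meson bounded_nat_set_is_finite)
qed

lemma common_prefix_length_ge:
  "v \<noteq> w \<Longrightarrow> has_prefix v u \<Longrightarrow> has_prefix w u \<Longrightarrow> length u \<le> common_prefix_length v w"
  unfolding common_prefix_length_def by (rule Max_ge[OF finite_common_prefix]) auto

lemma common_prefix_length_attained:
  assumes "v \<noteq> w"
  obtains u where "has_prefix v u" "has_prefix w u" "length u = common_prefix_length v w"
proof -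
  have "has_prefix x []" for x :: "'a fi_word" by (cases x) auto
  then have "{length u |u. has_prefix v u \<and> has_prefix w u} \<noteq> {}" by blast
  from Max_in[OF finite_common_prefix[OF assms] this] show ?thesis
    unfolding common_prefix_length_def[symmetric] using that by force
qed

lemma common_prefix_length_ultra:
  assumes "v \<noteq> w" "w \<noteq> z" "v \<noteq> z"
  shows "min (common_prefix_length v w) (common_prefix_length w z) \<le> common_prefix_length v z"
proof -
  define m where "m = min (common_prefix_length v w) (common_prefix_length w z)"
  obtain a where a: "has_prefix v a" "has_prefix w a" "length a = common_prefix_length v w"
    using common_prefix_length_attained[OF assms(1)] .
  obtain b where b: "has_prefix w b" "has_prefix z b" "length b = common_prefix_length w z"
    using common_prefix_length_attained[OF assms(2)] .
  have len: "length (take m a) = m" "length (take m b) = m" using a b by (auto simp: m_def)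
  have "take m a = take m b"
    by (rule has_prefix_unique[of w]) (use a b len has_prefix_take in auto)
  then have "has_prefix v (take m a)" "has_prefix z (take m a)"
    using a b has_prefix_take by metis+
  from common_prefix_length_ge[OF assms(3) this] show ?thesis using len by (simp add: m_def)
qed

lemma Metric_space_word_dist: "Metric_space M word_dist"
proof
  show "0 \<le> word_dist x y" for x y :: "'a fi_word" by (simp add: word_dist_def)
  show "word_dist x y = word_dist y x" for x y :: "'a fi_word"
    by (simp add: word_dist_def common_prefix_length_def conj_commute)
  show "word_dist x y = 0 \<longleftrightarrow> x = y" for x y :: "'a fi_word"
    by (auto simp: word_dist_def)
  show "word_dist x z \<le> word_dist x y + word_dist y z" for x y z :: "'a fi_word"
  proof (cases "x = y \<or> y = z \<or> x = z")
    case True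
    then show ?thesis by (auto simp: word_dist_def)
  next
    case False
    have le: "1 / (real n + 1) \<le> 1 / (real m + 1)" if "m \<le> n" for m n :: nat
      using that by (intro divide_left_mono) auto
    show ?thesis using common_prefix_length_ultra[of x y z] False
      by (auto simp: word_dist_def min_le_iff_disj intro: add_increasing add_increasing2 dest!: le)
  qed
qed

section \<open>Semidirect products and random walks\<close>

definition inner_semidirect :: "('a, 'b) monoid_scheme \<Rightarrow> 'a set \<Rightarrow> 'a set \<Rightarrow> bool" where
  "inner_semidirect H F A \<longleftrightarrow>
     F \<lhd> H \<and> subgroup A H \<and> F \<inter> A = {\<one>\<^bsub>H\<^esub>} \<and> F <#>\<^bsub>H\<^esub> A = carrier H"

inductive_set semigroup_span :: "('a, 'b) monoid_scheme \<Rightarrow> 'a set \<Rightarrow> 'a set"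
  for H :: "('a, 'b) monoid_scheme" and S :: "'a set" where
  incl: "s \<in> S \<Longrightarrow> s \<in> semigroup_span H S"
| mult: "g \<in> semigroup_span H S \<Longrightarrow> h \<in> semigroup_span H S \<Longrightarrow> g \<otimes>\<^bsub>H\<^esub> h \<in> semigroup_span H S"

definition nondegenerate :: "('a, 'b) monoid_scheme \<Rightarrow> 'a pmf \<Rightarrow> bool" where
  "nondegenerate H \<mu> \<longleftrightarrow> set_pmf \<mu> \<subseteq> carrier H \<and> semigroup_span H (set_pmf \<mu>) = carrier H"

definition path_space :: "('a, 'b) monoid_scheme \<Rightarrow> (nat \<Rightarrow> 'a) measure" where
  "path_space H = (\<Pi>\<^sub>M i\<in>UNIV. count_space (carrier H))"

text \<open>The Markov measure on the path space, given by its values on cylinders: the chain starts at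
  the identity and has transition probabilities \<open>\<mu> (g\<inverse> h)\<close>. For a countable group it exists
  and is unique; see below.\<close>

definition walk_measure :: "('a, 'b) monoid_scheme \<Rightarrow> 'a pmf \<Rightarrow> (nat \<Rightarrow> 'a) measure \<Rightarrow> bool" where
  "walk_measure H \<mu> P \<longleftrightarrow>
     prob_space P \<and> sets P = sets (path_space H) \<and>
     (\<forall>n g. range g \<subseteq> carrier H \<longrightarrow>
        measure P {\<tau> \<in> space P. \<forall>i\<le>n. \<tau> i = g i} =
          (if g 0 = \<one>\<^bsub>H\<^esub> then \<Prod>i<n. pmf \<mu> (inv\<^bsub>H\<^esub> (g i) \<otimes>\<^bsub>H\<^esub> g (Suc i)) else 0))"

lemma space_path_space: "space (path_space H) = {\<tau>. range \<tau> \<subseteq> carrier H}"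
  by (auto simp: path_space_def space_PiM PiE_def Pi_def)

lemma sets_path_space:
  assumes H: "group H" and C: "countable (carrier H)"
  shows "sets (path_space H) = sigma_sets {\<tau>. range \<tau> \<subseteq> carrier H}
     (insert {} {{\<tau>. range \<tau> \<subseteq> carrier H \<and> (\<forall>i\<le>n. \<tau> i = g i)} |n g. range g \<subseteq> carrier H})"
    (is "_ = sigma_sets ?\<Omega> ?E")
proof (rule antisym)
  interpret group H by fact
  have "{f \<in> ?\<Omega>. f i \<in> B} \<in> sigma_sets ?\<Omega> ?E" if B: "B \<subseteq> carrier H" for i :: nat and B
  proof -
    let ?c = "\<lambda>xs. {\<tau>. range \<tau> \<subseteq> carrier H \<and> (\<forall>j\<le>i. \<tau> j = xs ! j)}"
    let ?L = "{xs \<in> lists (carrier H). length xs = Suc i \<and> xs ! i \<in> B}"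
    have eq: "{f \<in> ?\<Omega>. f i \<in> B} = (\<Union>xs\<in>?L. ?c xs)"
    proof (intro equalityI subsetI)
      fix f assume f: "f \<in> {f \<in> ?\<Omega>. f i \<in> B}"
      then have "f j \<in> carrier H" for j by auto
      then have "map f [0..<Suc i] \<in> ?L" using f by (auto simp del: upt_Suc)
      moreover have "f \<in> ?c (map f [0..<Suc i])" using f by (auto simp del: upt_Suc)
      ultimately show "f \<in> (\<Union>xs\<in>?L. ?c xs)" by blast
    qed auto
    have cnt: "countable ?L"
      by (rule countable_subset[OF _ countable_lists[OF C]]) auto
    have mem: "?c xs \<in> sigma_sets ?\<Omega> ?E" if "xs \<in> ?L" for xs
    proof -
      define g where "g j = (if j \<le> i then xs ! j else \<one>\<^bsub>H\<^esub>)" for j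
      have "range g \<subseteq> carrier H" using that by (auto simp: g_def in_lists_conv_set)
      moreover have "?c xs = {\<tau>. range \<tau> \<subseteq> carrier H \<and> (\<forall>j\<le>i. \<tau> j = g j)}"
        by (auto simp: g_def)
      ultimately show ?thesis by (intro sigma_sets.Basic) blast
    qed
    show ?thesis
      unfolding eq by (rule sigma_sets_UNION) (use cnt mem in \<open>auto simp del: mem_Collect_eq\<close>)
  qed
  moreover have "(\<Pi>\<^sub>E i\<in>UNIV. space (count_space (carrier H))) = ?\<Omega>"
    by (auto simp: PiE_def Pi_def)
  ultimately show "sets (path_space H) \<subseteq> sigma_sets ?\<Omega> ?E"
    unfolding path_space_def sets_PiM_single
    by (simp only:, intro sigma_sets_mono) auto
next
  have "{\<tau>. range \<tau> \<subseteq> carrier H \<and> (\<forall>i\<le>n. \<tau> i = g i)} \<in> sets (path_space H)"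
    if "range g \<subseteq> carrier H" for n :: nat and g
  proof -
    have "{\<tau> \<in> space (path_space H). \<forall>i\<in>{..n}. \<tau> i \<in> {g i}} \<in> sets (path_space H)"
      unfolding path_space_def
      by (intro sets.sets_Collect_finite_All measurable_sets_Collect[OF measurable_component_singleton])
         (use that in auto)
    then show ?thesis by (simp add: space_path_space Ball_def)
  qed
  then show "sigma_sets ?\<Omega> ?E \<subseteq> sets (path_space H)"
    unfolding space_path_space[symmetric]
    by (intro sets.sigma_sets_subset) (auto simp: space_path_space)
qed

lemma walk_measure_unique:
  assumes H: "group H" and C: "countable (carrier H)"
    and P: "walk_measure H \<mu> P" and Q: "walk_measure H \<mu> Q"
  shows "P = Q"
proof -
  interpret group H by fact
  interpret P: prob_space P using P by (simp add: walk_measure_def)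
  interpret Q: prob_space Q using Q by (simp add: walk_measure_def)
  let ?\<Omega> = "{\<tau>. range \<tau> \<subseteq> carrier H} :: (nat \<Rightarrow> 'a) set"
  let ?c = "\<lambda>n g. {\<tau> :: nat \<Rightarrow> 'a. range \<tau> \<subseteq> carrier H \<and> (\<forall>i\<le>n. \<tau> i = g i)}"
  let ?E = "insert {} {?c n g |n g. range g \<subseteq> carrier H}"
  have sets: "sets P = sigma_sets ?\<Omega> ?E" "sets Q = sigma_sets ?\<Omega> ?E"
    using P Q sets_path_space[OF H C] by (simp_all add: walk_measure_def)
  have "space P = space (path_space H)" "space Q = space (path_space H)"
    using P Q unfolding walk_measure_def by (metis sets_eq_imp_space_eq)+
  then have space: "space P = ?\<Omega>" "space Q = ?\<Omega>"
    by (simp_all add: space_path_space)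
  show ?thesis
  proof (rule measure_eqI_generator_eq_countable[OF _ _ _ sets])
    have *: "?c n g \<inter> ?c m h \<in> ?E"
      if "n \<le> m" "range g \<subseteq> carrier H" "range h \<subseteq> carrier H" for n m g h
    proof (cases "\<forall>i\<le>n. g i = h i")
      case True
      then have "?c n g \<inter> ?c m h = ?c m h" using that(1) by auto
      then show ?thesis using that(3) by blast
    next
      case False
      then obtain i where "i \<le> n" "g i \<noteq> h i" by blast
      then have "?c n g \<inter> ?c m h = {}" using that(1) by (auto; metis order.trans)
      then show ?thesis by blast
    qed
    show "Int_stable ?E"
    proof (rule Int_stableI)
      fix a b assume ab: "a \<in> ?E" "b \<in> ?E"
      show "a \<inter> b \<in> ?E"
      proof (cases "a = {} \<or> b = {}")
        case True
        then show ?thesis by auto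
      next
        case False
        then obtain n g m h where "a = ?c n g" "range g \<subseteq> carrier H" "b = ?c m h" "range h \<subseteq> carrier H"
          using ab by blast
        then show ?thesis using *[of n m g h] *[of m n h g] by (metis Int_commute nat_le_linear)
      qed
    qed
    show "emeasure P X = emeasure Q X" if "X \<in> ?E" for X
      using that P Q space
      by (auto simp: P.emeasure_eq_measure Q.emeasure_eq_measure walk_measure_def)
    show "(\<lambda>a. ?c 0 (\<lambda>_. a)) ` carrier H \<subseteq> ?E" by blast
    show "\<Union> ((\<lambda>a. ?c 0 (\<lambda>_. a)) ` carrier H) = ?\<Omega>" by auto
    show "countable ((\<lambda>a. ?c 0 (\<lambda>_. a)) ` carrier H)" using C by simp
  qed auto
qed

lemma walk_measure_exists:
  assumes H: "group H" and C: "countable (carrier H)" and \<mu>: "set_pmf \<mu> \<subseteq> carrier H"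
  shows "\<exists>P. walk_measure H \<mu> P"
proof -
  interpret group H by fact
  define S where "S = restrict_space (measure_pmf \<mu>) (carrier H)"
  have spS: "space S = carrier H" and seS: "sets S = Pow (carrier H)"
    by (auto simp: S_def space_restrict_space sets_restrict_space)
  have emS: "emeasure S {x} = pmf \<mu> x" if "x \<in> carrier H" for x
    using that by (simp add: S_def emeasure_restrict_space emeasure_pmf_single)
  have "prob_space S" unfolding S_def
    by (rule prob_space_restrict_space)
       (use \<mu> in \<open>auto simp: measure_pmf.emeasure_eq_measure measure_pmf.prob_eq_1 AE_measure_pmf_iff\<close>)
  then interpret S: prob_space S .
  interpret PP: product_prob_space "\<lambda>_. S" "UNIV :: nat set" ..
  let ?I = "PiM (UNIV :: nat set) (\<lambda>_. S)"
  define W where "W \<omega> n = rec_nat \<one>\<^bsub>H\<^esub> (\<lambda>i g. g \<otimes>\<^bsub>H\<^esub> \<omega> i) n" for \<omega> and n :: nat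
  have W0: "W \<omega> 0 = \<one>\<^bsub>H\<^esub>" and WS: "W \<omega> (Suc n) = W \<omega> n \<otimes>\<^bsub>H\<^esub> \<omega> n" for \<omega> n
    by (auto simp: W_def)
  have spI: "\<omega> i \<in> carrier H" if "\<omega> \<in> space ?I" for \<omega> i
    using that spS by (auto simp: space_PiM PiE_def Pi_def)
  have Wc: "W \<omega> n \<in> carrier H" if "\<omega> \<in> space ?I" for \<omega> n
    by (induction n) (use that spI in \<open>auto simp: W0 WS\<close>)
  have meas: "(\<lambda>\<omega>. W \<omega> n) \<in> measurable ?I (count_space (carrier H))" for n
  proof (induction n)
    case 0
    then show ?case by (simp add: W0)
  next
    case (Suc n)
    have "(\<lambda>\<omega>. g \<otimes>\<^bsub>H\<^esub> \<omega> n) \<in> measurable ?I (count_space (carrier H))" if "g \<in> carrier H" for g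
    proof (rule measurable_compose[where f = "\<lambda>\<omega>. \<omega> n" and g = "\<lambda>x. g \<otimes>\<^bsub>H\<^esub> x"])
      show "(\<lambda>\<omega>. \<omega> n) \<in> measurable ?I S" by simp
      show "(\<lambda>x. g \<otimes>\<^bsub>H\<^esub> x) \<in> measurable S (count_space (carrier H))"
        using that by (auto simp: measurable_def spS seS)
    qed
    from measurable_compose_countable'[OF this Suc C] show ?case by (simp add: WS)
  qed
  have measW: "W \<in> measurable ?I (path_space H)"
    unfolding path_space_def by (rule measurable_PiM_single') (use meas Wc in \<open>auto simp: space_PiM\<close>)
  let ?P = "distr ?I (path_space H) W"
  have "walk_measure H \<mu> ?P"
    unfolding walk_measure_def
  proof (intro conjI allI impI)
    show "prob_space ?P" by (rule PP.prob_space_distr) (rule measW)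
    show "sets ?P = sets (path_space H)" by simp
    fix n and g :: "nat \<Rightarrow> 'a" assume g: "range g \<subseteq> carrier H"
    then have gc[simp]: "g i \<in> carrier H" for i by auto
    let ?A = "{\<tau> \<in> space (path_space H). \<forall>i\<le>n. \<tau> i = g i}"
    have A: "?A \<in> sets (path_space H)"
      unfolding sets_path_space[OF H C] space_path_space by (intro sigma_sets.Basic) (use g in auto)
    have eq: "emeasure ?P ?A = emeasure ?I {\<omega> \<in> space ?I. \<forall>i\<le>n. W \<omega> i = g i}"
      using measurable_space[OF measW]
      by (subst emeasure_distr[OF measW A]) (auto intro!: arg_cong[where f = "emeasure ?I"])
    have "measure ?P ?A = (if g 0 = \<one>\<^bsub>H\<^esub> then \<Prod>i<n. pmf \<mu> (inv\<^bsub>H\<^esub> (g i) \<otimes>\<^bsub>H\<^esub> g (Suc i)) else 0)"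
    proof (cases "g 0 = \<one>\<^bsub>H\<^esub>")
      case True
      have step: "W \<omega> (Suc i) = g (Suc i) \<longleftrightarrow> \<omega> i = inv\<^bsub>H\<^esub> (g i) \<otimes>\<^bsub>H\<^esub> g (Suc i)"
        if "\<omega> \<in> space ?I" "W \<omega> i = g i" for \<omega> i
      proof -
        have "\<omega> i = inv\<^bsub>H\<^esub> (g i) \<otimes>\<^bsub>H\<^esub> g (Suc i) \<longleftrightarrow> g (Suc i) = g i \<otimes>\<^bsub>H\<^esub> \<omega> i"
          using spI[OF that(1)] by (intro inv_solve_left) auto
        moreover have "W \<omega> (Suc i) = g i \<otimes>\<^bsub>H\<^esub> \<omega> i"
          by (simp only: WS that(2))
        ultimately show ?thesis by metis
      qed
      have "(\<forall>i\<le>n. W \<omega> i = g i) \<longleftrightarrow> (\<forall>i\<in>{..<n}. \<omega> i \<in> {inv\<^bsub>H\<^esub> (g i) \<otimes>\<^bsub>H\<^esub> g (Suc i)})"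
        if "\<omega> \<in> space ?I" for \<omega>
      proof (induction n)
        case 0
        then show ?case by (simp add: W0 True)
      next
        case (Suc n)
        have "(\<forall>i\<le>Suc n. W \<omega> i = g i) \<longleftrightarrow> (\<forall>i\<le>n. W \<omega> i = g i) \<and> W \<omega> (Suc n) = g (Suc n)"
          by (auto simp: le_Suc_eq)
        then show ?case using Suc.IH step[OF that, of n] by (auto simp: less_Suc_eq)
      qed
      then have "{\<omega> \<in> space ?I. \<forall>i\<le>n. W \<omega> i = g i} =
          {\<omega> \<in> space ?I. \<forall>i\<in>{..<n}. \<omega> i \<in> {inv\<^bsub>H\<^esub> (g i) \<otimes>\<^bsub>H\<^esub> g (Suc i)}}" by blast
      then have "emeasure ?P ?A = (\<Prod>i<n. emeasure S {inv\<^bsub>H\<^esub> (g i) \<otimes>\<^bsub>H\<^esub> g (Suc i)})"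
        unfolding eq by (simp only:, intro PP.emeasure_PiM_Collect) (auto simp: seS)
      also have "\<dots> = ennreal (\<Prod>i<n. pmf \<mu> (inv\<^bsub>H\<^esub> (g i) \<otimes>\<^bsub>H\<^esub> g (Suc i)))"
        by (simp add: emS prod_ennreal)
      finally show ?thesis using True by (simp add: measure_def prod_nonneg)
    next
      case False
      then have "{\<omega> \<in> space ?I. \<forall>i\<le>n. W \<omega> i = g i} = {}"
        using W0 by (metis (mono_tags, lifting) empty_Collect_eq le0)
      then have "emeasure ?P ?A = 0" using eq by (simp only: emeasure_empty)
      then show ?thesis using False by (simp add: measure_def)
    qed
    then show "measure ?P {\<tau> \<in> space ?P. \<forall>i\<le>n. \<tau> i = g i} =
      (if g 0 = \<one>\<^bsub>H\<^esub> then \<Prod>i<n. pmf \<mu> (inv\<^bsub>H\<^esub> (g i) \<otimes>\<^bsub>H\<^esub> g (Suc i)) else 0)" by simp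
  qed
  then show ?thesis ..
qed

end

theory Submission
  imports Defs "HOL-Complex_Analysis.Great_Picard"
begin

text \<open>Fix an \<open>A\<close>-invariant \<open>u \<noteq> 1\<close> in \<open>F\<close>. For the path \<open>\<tau>\<^sub>i = x\<^sub>i\<alpha>\<^sub>i\<close> the conjugate
  \<open>w\<^sub>i = \<tau>\<^sub>i u \<tau>\<^sub>i\<inverse> = x\<^sub>i u x\<^sub>i\<inverse>\<close> lies in \<open>F\<close>, and \<open>\<tau>\<^sub>i u\<^sup>k = w\<^sub>i\<^sup>k \<tau>\<^sub>i\<close>. Take a finitely additive
  \<open>\<mu>\<close>-stationary mean \<open>\<nu>\<close>, obtained from Cesaro averages of the laws of the walk. The functions
  \<open>h \<mapsto> \<nu> (h\<inverse>C)\<close> are bounded and harmonic, so by the orthogonality of martingale increments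
  \<open>\<tau>\<^sub>i\<nu>\<close>, \<open>\<tau>\<^sub>i\<^sub>+\<^sub>1\<nu>\<close> and \<open>\<tau>\<^sub>i g\<nu>\<close> become asymptotically equal almost surely; in particular \<open>\<tau>\<^sub>i\<nu>\<close> becomes
  asymptotically invariant under every fixed power of \<open>w\<^sub>i\<close>.

  If some \<open>w\<close> occurred infinitely often among the \<open>w\<^sub>i\<close>, then \<open>\<tau>\<^sub>i\<nu>\<close> would give substantial mass to
  all neighbourhoods of the two fixed points of \<open>w\<close> on \<open>\<partial>F\<close>; by the maximal inequality this has
  probability zero because \<open>\<nu>\<close> does not charge those points. Hence \<open>|w\<^sub>i|\<close> tends to infinity. Words
  that do not start like \<open>w\<^sub>i\<close> are then moved by the powers of \<open>w\<^sub>i\<close> to disjoint places, so that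
  almost all the mass of \<open>\<tau>\<^sub>i\<nu>\<close> sits on words with the same initial segment as \<open>w\<^sub>i\<close>. As \<open>\<tau>\<^sub>i\<nu>\<close>
  and \<open>\<tau>\<^sub>i\<^sub>+\<^sub>1\<nu>\<close> are close, this segment stabilises, and \<open>x\<^sub>i\<close> shares a long prefix with \<open>w\<^sub>i\<close>.\<close>

section \<open>Lengths and common prefixes of reduced words\<close>

abbreviation common_prefix :: "'l list \<Rightarrow> 'l list \<Rightarrow> nat" where
  "common_prefix u v \<equiv> length (longest_common_prefix u v)"

lemma longest_common_prefix_commute: "longest_common_prefix u v = longest_common_prefix v u"
proof (induction u v rule: longest_common_prefix.induct)
  case ("2_1" v)
  then show ?case by (cases v) auto
next
  case ("2_2" u)
  then show ?case by (cases u) auto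
qed auto

lemma le_common_prefix_iff:
  "n \<le> common_prefix u v \<longleftrightarrow> n \<le> length u \<and> n \<le> length v \<and> take n u = take n v"
proof (induction u v arbitrary: n rule: longest_common_prefix.induct)
  case (1 x xs y ys)
  then show ?case by (cases n) auto
qed auto

definition formal_inverse :: "'a letter list \<Rightarrow> 'a letter list" where
  "formal_inverse u = map (apsnd Not) (rev u)"

lemma length_formal_inverse [simp]: "length (formal_inverse u) = length u"
  by (simp add: formal_inverse_def)

lemma formal_inverse_reduced: "u \<in> reduced_words X \<Longrightarrow> formal_inverse u \<in> reduced_words X"
  by (force simp: reduced_words_def formal_inverse_def successively_map cancelling_def
      elim: successively_mono)

section \<open>Word length and Gromov product in a free group\<close>

locale free_subgroup = group H for H :: "('a, 'b) monoid_scheme" (structure) +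
  fixes F X :: "'a set"
  assumes subgroup_F: "subgroup F H"
    and free_basis: "free_basis H F X"
    and finite_X: "finite X"
begin

lemma inv_mult_cancel:
  "x \<in> carrier H \<Longrightarrow> y \<in> carrier H \<Longrightarrow> inv x \<otimes> (x \<otimes> y) = y"
  "x \<in> carrier H \<Longrightarrow> y \<in> carrier H \<Longrightarrow> x \<otimes> (inv x \<otimes> y) = y"
  by (simp_all flip: m_assoc)

lemma F_closed [simp, intro]: "x \<in> F \<Longrightarrow> x \<in> carrier H"
  using subgroup.subset[OF subgroup_F] by blast

lemma F_mult [simp, intro]: "x \<in> F \<Longrightarrow> y \<in> F \<Longrightarrow> x \<otimes> y \<in> F"
  and F_inv [simp, intro]: "x \<in> F \<Longrightarrow> inv x \<in> F"
  and F_one [simp, intro]: "\<one> \<in> F"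
  using subgroup_F by (auto simp: subgroup.m_closed subgroup.m_inv_closed subgroup.one_closed)

lemma F_pow [simp, intro]: "x \<in> F \<Longrightarrow> x [^] (n::nat) \<in> F"
  by (induction n) auto

lemma X_F [simp, intro]: "x \<in> X \<Longrightarrow> x \<in> F"
  using free_basis by (auto simp: free_basis_def)

definition rf :: "'a \<Rightarrow> 'a letter list" where "rf = reduced_form H X"

definition len :: "'a \<Rightarrow> nat" where "len x = length (rf x)"

text \<open>The Gromov product at the identity: in the Cayley tree the geodesics from
  \<open>\<one>\<close> to \<open>x\<close> and to \<open>y\<close> run together for this
  length.\<close>

definition cp :: "'a \<Rightarrow> 'a \<Rightarrow> nat" where "cp x y = common_prefix (rf x) (rf y)"

lemma bij_word_value: "bij_betw (word_value H) (reduced_words X) F"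
  using free_basis by (simp add: free_basis_def)

lemma rf_reduced [simp]: "x \<in> F \<Longrightarrow> rf x \<in> reduced_words X"
  and word_value_rf [simp]: "x \<in> F \<Longrightarrow> word_value H (rf x) = x"
  using bij_word_value
  by (auto simp: rf_def reduced_form_def bij_betw_def the_inv_into_into f_the_inv_into_f)

lemma rf_word_value: "u \<in> reduced_words X \<Longrightarrow> rf (word_value H u) = u"
  using bij_word_value by (auto simp: rf_def reduced_form_def bij_betw_def the_inv_into_f_f)

lemma rf_inj: "x \<in> F \<Longrightarrow> y \<in> F \<Longrightarrow> rf x = rf y \<Longrightarrow> x = y"
  by (metis word_value_rf)

lemma letter_value_closed [simp]: "fst p \<in> X \<Longrightarrow> letter_value H p \<in> carrier H"
  by (auto simp: letter_value_def)

lemma word_value_closed [simp]: "fst ` set u \<subseteq> X \<Longrightarrow> word_value H u \<in> carrier H"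
  by (induction u) (auto simp: word_value_def)

lemma word_value_Cons: "word_value H (p # u) = letter_value H p \<otimes> word_value H u"
  by (simp add: word_value_def)

lemma word_value_Nil [simp]: "word_value H [] = \<one>"
  by (simp add: word_value_def)

lemma word_value_append:
  "fst ` set u \<subseteq> X \<Longrightarrow> fst ` set v \<subseteq> X \<Longrightarrow> word_value H (u @ v) = word_value H u \<otimes> word_value H v"
  by (induction u) (auto simp: word_value_Cons m_assoc)

lemma word_value_formal_inverse:
  "fst ` set u \<subseteq> X \<Longrightarrow> word_value H (formal_inverse u) = inv (word_value H u)"
proof (induction u)
  case Nil
  then show ?case by (simp add: formal_inverse_def)
next
  case (Cons p u)
  have p: "word_value H (formal_inverse [p]) = inv (letter_value H p)"
    using Cons.prems by (auto simp: formal_inverse_def word_value_Cons letter_value_def)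
  have "word_value H (formal_inverse (p # u)) = word_value H (formal_inverse u @ formal_inverse [p])"
    by (simp add: formal_inverse_def)
  also have "\<dots> = word_value H (formal_inverse u) \<otimes> word_value H (formal_inverse [p])"
    by (rule word_value_append) (use Cons.prems in \<open>auto simp: formal_inverse_def\<close>)
  finally show ?case using Cons by (simp add: p word_value_Cons inv_mult_group)
qed

lemma rf_letters: "x \<in> F \<Longrightarrow> fst ` set (rf x) \<subseteq> X"
  using rf_reduced[of x] by (auto simp: reduced_words_def)

lemma rf_inv: "x \<in> F \<Longrightarrow> rf (inv x) = formal_inverse (rf x)"
  using rf_word_value[OF formal_inverse_reduced[OF rf_reduced]]
  by (simp add: word_value_formal_inverse rf_letters)

lemma rf_one [simp]: "rf \<one> = []"
  using rf_word_value[of "[]"] by (simp add: reduced_words_def)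

lemma len_one [simp]: "len \<one> = 0"
  by (simp add: len_def)

lemma len_eq_0_iff: "x \<in> F \<Longrightarrow> len x = 0 \<longleftrightarrow> x = \<one>"
  using rf_inj[of x \<one>] by (auto simp: len_def)

lemma len_inv [simp]: "x \<in> F \<Longrightarrow> len (inv x) = len x"
  by (simp add: len_def rf_inv)

lemma cp_commute: "cp x y = cp y x"
  by (simp add: cp_def longest_common_prefix_commute)

lemma le_cp_iff: "n \<le> cp x y \<longleftrightarrow> n \<le> len x \<and> n \<le> len y \<and> take n (rf x) = take n (rf y)"
  by (simp add: cp_def len_def le_common_prefix_iff)

text \<open>The tree is 0-hyperbolic. The threshold \<open>n\<close> lets agreements be chained
  without handling minima.\<close>

lemma cp_ultra: "n \<le> cp x y \<Longrightarrow> n \<le> cp y z \<Longrightarrow> n \<le> cp x z"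
  by (simp add: le_cp_iff)

lemma cp_le: "cp x y \<le> len x" "cp x y \<le> len y"
  using le_cp_iff[of "cp x y" x y] by auto

lemma cp_self [simp]: "cp x x = len x"
  using le_cp_iff[of "len x" x x] cp_le[of x x] by auto

lemma finite_len_le: "finite {x \<in> F. len x \<le> n}"
proof -
  have "finite {u. set u \<subseteq> X \<times> (UNIV :: bool set) \<and> length u \<le> n}"
    by (rule finite_lists_length_le) (use finite_X in simp)
  moreover have "rf ` {x \<in> F. len x \<le> n} \<subseteq> {u. set u \<subseteq> X \<times> UNIV \<and> length u \<le> n}"
    using rf_letters by (force simp: len_def)
  moreover have "inj_on rf {x \<in> F. len x \<le> n}"
    by (rule inj_onI) (use rf_inj in auto)
  ultimately show ?thesis using finite_imageD finite_subset by blast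
qed

text \<open>Cutting off the longest common prefix leaves \<open>a\<close> and \<open>b\<close> with
  different first letters, so \<open>formal_inverse a @ b\<close> is already reduced and spells
  \<open>inv x \<otimes> y\<close>. This is the distance formula of the tree, written additively to
  avoid truncated subtraction.\<close>

lemma len_inv_mult:
  assumes x: "x \<in> F" and y: "y \<in> F"
  shows "len (inv x \<otimes> y) + 2 * cp x y = len x + len y"
proof -
  define p where "p = longest_common_prefix (rf x) (rf y)"
  obtain a b where a: "rf x = p @ a" and b: "rf y = p @ b"
    using longest_common_prefix_prefix1[of "rf x" "rf y"]
      longest_common_prefix_prefix2[of "rf x" "rf y"]
    unfolding p_def[symmetric] by (auto elim!: prefixE)
  have ne: "hd a \<noteq> hd b" if "a \<noteq> []" "b \<noteq> []"
  proof
    assume "hd a = hd b"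
    then have "prefix (p @ [hd a]) (rf x)" "prefix (p @ [hd a]) (rf y)"
      unfolding a b using that by (metis Cons_prefix_Cons append_Nil hd_Cons_tl same_prefix_prefix prefix_bot.bot_least)+
    from longest_common_prefix_max_prefix[OF this] show False
      unfolding p_def[symmetric] by (auto dest: prefix_length_le)
  qed
  have red: "p @ a \<in> reduced_words X" "p @ b \<in> reduced_words X"
    using rf_reduced[OF x] rf_reduced[OF y] by (simp_all add: a b)
  then have sub: "fst ` set p \<subseteq> X" "fst ` set a \<subseteq> X" "fst ` set b \<subseteq> X"
    by (auto simp: reduced_words_def)
  have "a \<in> reduced_words X" "b \<in> reduced_words X"
    using red by (auto simp: reduced_words_def successively_append_iff)
  \<comment> \<open>At the seam the formal inverse of \<open>hd a\<close> meets \<open>hd b\<close>;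
    they could cancel only if \<open>hd a = hd b\<close>.\<close>
  then have r: "formal_inverse a @ b \<in> reduced_words X"
    using formal_inverse_reduced[of a X] ne
    by (auto simp: reduced_words_def successively_append_iff formal_inverse_def last_map last_rev
        cancelling_def prod_eq_iff)
  have "inv x \<otimes> y = inv (word_value H p \<otimes> word_value H a) \<otimes> (word_value H p \<otimes> word_value H b)"
    using word_value_rf[OF x] word_value_rf[OF y] word_value_append sub by (simp add: a b)
  also have "\<dots> = inv (word_value H a) \<otimes> word_value H b"
    using sub by (simp add: inv_mult_group m_assoc inv_mult_cancel)
  also have "\<dots> = word_value H (formal_inverse a @ b)"
    using sub word_value_formal_inverse[of a]
    by (subst word_value_append) (auto simp: formal_inverse_def)
  finally have "rf (inv x \<otimes> y) = formal_inverse a @ b" by (simp add: rf_word_value r)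
  moreover have "cp x y = length p" by (simp add: cp_def p_def)
  ultimately show ?thesis by (simp add: len_def a b)
qed

lemma len_mult: "x \<in> F \<Longrightarrow> y \<in> F \<Longrightarrow> len (x \<otimes> y) + 2 * cp (inv x) y = len x + len y"
  using len_inv_mult[of "inv x" y] by simp

text \<open>If \<open>u\<close> and \<open>inv u\<close> agreed on half of the length, letter
  \<open>j\<close> would be the formal inverse of letter \<open>n - 1 - j\<close>. In the middle, a
  letter would be its own inverse (\<open>n\<close> odd) or two neighbours would cancel
  (\<open>n\<close> even).\<close>

lemma cp_inv_less:
  assumes u: "u \<in> F" "u \<noteq> \<one>"
  shows "2 * cp u (inv u) < len u"
proof (rule ccontr)
  assume "\<not> ?thesis"
  then have c: "len u \<le> 2 * cp u (inv u)" by simp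
  define n where "n = len u"
  have n0: "n > 0" using u len_eq_0_iff[of u] by (simp add: n_def)
  have ln: "length (rf u) = n" by (simp add: n_def len_def)
  have eq: "rf u ! j = apsnd Not (rf u ! (n - Suc j))" if "j < cp u (inv u)" for j
  proof -
    have "take (cp u (inv u)) (rf u) = take (cp u (inv u)) (rf (inv u))"
      using le_cp_iff[of "cp u (inv u)" u "inv u"] by simp
    then have "rf u ! j = formal_inverse (rf u) ! j"
      using that u by (metis nth_take rf_inv)
    moreover have "j < n" using that cp_le(1)[of u "inv u"] by (simp add: n_def)
    ultimately show ?thesis by (simp add: formal_inverse_def rev_nth ln)
  qed
  show False
  proof (cases "odd n")
    case True
    then obtain j where j: "n = 2 * j + 1" by (elim oddE)
    then have "rf u ! j = apsnd Not (rf u ! j)" using eq[of j] c by (simp add: n_def)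
    then show False by (cases "rf u ! j") simp
  next
    case False
    then obtain q where "n = 2 * q" by (auto elim: evenE)
    then obtain j where j: "n = 2 * Suc j" using n0 by (cases q) auto
    then have e: "rf u ! j = apsnd Not (rf u ! Suc j)" using eq[of j] c by (simp add: n_def)
    have "drop j (rf u) = rf u ! j # rf u ! Suc j # drop (Suc (Suc j)) (rf u)"
      using j ln by (simp add: Cons_nth_drop_Suc)
    moreover have "successively (\<lambda>p q. \<not> cancelling p q) (take j (rf u) @ drop j (rf u))"
      using rf_reduced[OF u(1)] by (simp add: reduced_words_def)
    ultimately have "\<not> cancelling (rf u ! j) (rf u ! Suc j)"
      by (simp add: successively_append_iff)
    then show False using e by (auto simp: cancelling_def)
  qed
qed

subsection \<open>Translation along axes in the Cayley tree\<close>

text \<open>The reduced word of \<open>w\<close> has the form \<open>p c p^-1\<close> with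
  \<open>c\<close> cyclically reduced. This is the length of \<open>p\<close>;
  \<open>translation_length w\<close> is the length of \<open>c\<close>, by which \<open>w\<close>
  shifts its axis.\<close>

definition axis_dist :: "'a \<Rightarrow> nat" where "axis_dist w = cp w (inv w)"

definition translation_length :: "'a \<Rightarrow> nat" where
  "translation_length w = len w - 2 * axis_dist w"

lemma translation_length_pos: "w \<in> F \<Longrightarrow> w \<noteq> \<one> \<Longrightarrow> 0 < translation_length w"
  using cp_inv_less[of w] by (simp add: translation_length_def axis_dist_def)

lemma len_axis: "w \<in> F \<Longrightarrow> len w = 2 * axis_dist w + translation_length w"
  using cp_inv_less[of w] cp_le[of w "inv w"]
  by (cases "w = \<one>") (simp_all add: translation_length_def axis_dist_def)

lemma axis_dist_inv [simp]: "w \<in> F \<Longrightarrow> axis_dist (inv w) = axis_dist w"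
  by (simp add: axis_dist_def cp_commute)

lemma translation_length_inv [simp]: "w \<in> F \<Longrightarrow> translation_length (inv w) = translation_length w"
  by (simp add: translation_length_def)

lemma inv_pow: "w \<in> F \<Longrightarrow> inv (w [^] (k::nat)) = inv w [^] k"
  by (simp add: nat_pow_inv)

lemma inv_pow_mult_pow:
  "w \<in> F \<Longrightarrow> k \<le> l \<Longrightarrow> inv (w [^] (k::nat)) \<otimes> w [^] l = w [^] (l - k)"
  using nat_pow_mult[of w k "l - k"] inv_mult_cancel(1)[of "w [^] k" "w [^] (l - k)"] by simp

text \<open>Both claims go through one induction: the agreement with \<open>inv w\<close> gives the
  length of the next power, this length shows that the next power follows \<open>w\<close> beyond
  \<open>axis_dist w\<close>, and so it leaves \<open>inv w\<close> where \<open>w\<close>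
  does.\<close>

lemma len_pow_aux:
  assumes w: "w \<in> F" "w \<noteq> \<one>"
  shows "len (w [^] Suc k) = 2 * axis_dist w + Suc k * translation_length w
    \<and> cp (inv w) (w [^] Suc k) = axis_dist w"
proof (induction k)
  case 0
  then show ?case using w len_axis[of w] by (simp add: axis_dist_def cp_commute)
next
  case (Suc k)
  have "len (inv (inv w) \<otimes> w [^] Suc k) + 2 * cp (inv w) (w [^] Suc k) = len (inv w) + len (w [^] Suc k)"
    by (rule len_inv_mult) (use w in auto)
  moreover have "inv (inv w) \<otimes> w [^] Suc k = w [^] Suc (Suc k)"
    using w by (simp only: inv_inv F_closed nat_pow_Suc2[symmetric])
  ultimately have len: "len (w [^] Suc (Suc k)) = 2 * axis_dist w + Suc (Suc k) * translation_length w"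
    using Suc w len_axis[of w] by simp
  have "len (inv w \<otimes> w [^] Suc (Suc k)) + 2 * cp w (w [^] Suc (Suc k)) = len w + len (w [^] Suc (Suc k))"
    by (rule len_inv_mult) (use w in auto)
  moreover have "inv w \<otimes> w [^] Suc (Suc k) = w [^] Suc k"
    using inv_pow_mult_pow[of w 1 "Suc (Suc k)"] w by simp
  ultimately have "cp w (w [^] Suc (Suc k)) = axis_dist w + translation_length w"
    using Suc len len_axis[of w] w by simp
  then have *: "axis_dist w < cp w (w [^] Suc (Suc k))" using translation_length_pos[OF w] by simp
  have "axis_dist w \<le> cp (inv w) (w [^] Suc (Suc k))"
    by (rule cp_ultra[of _ _ w]) (use * in \<open>auto simp: axis_dist_def cp_commute\<close>)
  moreover have "\<not> Suc (axis_dist w) \<le> cp (inv w) (w [^] Suc (Suc k))"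
  proof
    assume "Suc (axis_dist w) \<le> cp (inv w) (w [^] Suc (Suc k))"
    then have "Suc (axis_dist w) \<le> cp w (inv w)"
      using * by - (rule cp_ultra[of _ w "w [^] Suc (Suc k)"], auto simp: cp_commute)
    then show False by (simp add: axis_dist_def)
  qed
  ultimately show ?case using len by simp
qed

lemma len_pow:
  assumes "w \<in> F" "w \<noteq> \<one>" "1 \<le> k"
  shows "len (w [^] k) = 2 * axis_dist w + k * translation_length w"
  using len_pow_aux[OF assms(1,2), of "k - 1"] assms(3) by (cases k) auto

lemma pow_neq_one:
  assumes "w \<in> F" "w \<noteq> \<one>" "1 \<le> k" shows "w [^] (k::nat) \<noteq> \<one>"
  using len_pow[OF assms] translation_length_pos[OF assms(1,2)] assms(3) by auto

text \<open>The bound is the depth at which the geodesic to \<open>w [^] k\<close> leaves the axis.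
  It follows from the lengths of the two powers and of their quotient
  \<open>w [^] (l - k)\<close>.\<close>

lemma cp_pow:
  assumes w: "w \<in> F" "w \<noteq> \<one>" and kl: "1 \<le> k" "k \<le> l"
  shows "axis_dist w + k * translation_length w \<le> cp (w [^] k) (w [^] l)"
proof (cases "k = l")
  case True
  then show ?thesis using len_pow[OF w kl(1)] by simp
next
  case False
  then obtain m where m: "l = k + m" "1 \<le> m" using kl by (metis le_iff_add add_0_right less_one not_le)
  have "len (w [^] m) + 2 * cp (w [^] k) (w [^] l) = len (w [^] k) + len (w [^] l)"
    using len_inv_mult[of "w [^] k" "w [^] l"] inv_pow_mult_pow[of w k l] w m by simp
  then show ?thesis using len_pow[OF w] kl m by (simp add: algebra_simps)
qed

text \<open>North-south dynamics. Cancellation in \<open>w [^] n \<otimes> y\<close> is limited by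
  the agreement of \<open>y\<close> with the repelling direction, which ends before \<open>k\<close>
  periods of the axis; the other \<open>n - k\<close> periods survive in a prefix shared with
  \<open>w [^] n\<close>.\<close>

lemma cp_pow_mult:
  assumes w: "w \<in> F" "w \<noteq> \<one>" and y: "y \<in> F" and k: "1 \<le> k" "k \<le> n"
    and less: "cp y (inv w [^] k) < axis_dist w + k * translation_length w"
  shows "axis_dist w + (n - k) * translation_length w < cp (w [^] n \<otimes> y) (w [^] n)"
proof -
  have iw: "inv w \<in> F" "inv w \<noteq> \<one>" using w inv_eq_1_iff by auto
  have "cp (inv w [^] n) y < axis_dist w + k * translation_length w"
  proof (rule ccontr)
    assume "\<not> ?thesis"
    then have "axis_dist w + k * translation_length w \<le> cp y (inv w [^] k)"
      using cp_pow[OF iw k] w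
      by - (rule cp_ultra[of _ _ "inv w [^] n"], auto simp: cp_commute)
    then show False using less by simp
  qed
  moreover have "len (w [^] n \<otimes> y) + 2 * cp (inv w [^] n) y = len (w [^] n) + len y"
    using len_mult[of "w [^] n" y] w y by (simp add: inv_pow)
  moreover have "len y + 2 * cp (w [^] n \<otimes> y) (w [^] n) = len (w [^] n \<otimes> y) + len (w [^] n)"
  proof -
    have "inv (w [^] n \<otimes> y) \<otimes> w [^] n = inv y" using w y by (simp add: inv_mult_group m_assoc)
    then show ?thesis using len_inv_mult[of "w [^] n \<otimes> y" "w [^] n"] w y by simp
  qed
  moreover have "n * translation_length w = (n - k) * translation_length w + k * translation_length w"
    using k by (simp flip: add_mult_distrib)
  moreover have "len (w [^] n) = 2 * axis_dist w + n * translation_length w"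
    using len_pow[OF w] k by simp
  ultimately show ?thesis by linarith
qed

text \<open>The axis of \<open>w\<close> is at distance \<open>axis_dist w\<close> from the identity; \<open>w\<close> pushes every point
  that branches off earlier towards the axis.\<close>

lemma pow_attracts:
  assumes w: "w \<in> F" "w \<noteq> \<one>" and y: "y \<in> F" and n: "1 \<le> (n::nat)"
    and less: "cp y w < axis_dist w"
  shows "axis_dist w \<le> cp (w [^] n \<otimes> y) w"
proof -
  \<comment> \<open>The words of \<open>w\<close> and \<open>inv w\<close> coincide up to depth
    \<open>axis_dist w\<close>, so \<open>y\<close> branches off both before the axis is
    reached.\<close>
  have "cp y (inv w) < axis_dist w"
  proof (rule ccontr)
    assume "\<not> ?thesis"
    then have "axis_dist w \<le> cp y w"
      by - (rule cp_ultra[of _ _ "inv w"], auto simp: cp_commute axis_dist_def)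
    then show False using less by simp
  qed
  then have "axis_dist w + (n - 1) * translation_length w < cp (w [^] n \<otimes> y) (w [^] n)"
    by (intro cp_pow_mult[OF w y _ n]) (use w in auto)
  then show ?thesis
    using cp_pow[OF w _ n] w by - (rule cp_ultra[of _ _ "w [^] n"], auto simp: cp_commute)
qed

section \<open>Neighbourhoods of the two ends of an axis\<close>

text \<open>Neighbourhoods of the attracting and the repelling boundary point of \<open>w\<close>,
  described by finite words only. For \<open>k = 0\<close> the power is the identity and the
  condition degenerates, hence the index \<open>Suc k\<close> later on.\<close>

definition near_ends :: "'a \<Rightarrow> nat \<Rightarrow> 'a set" where
  "near_ends w k = {y \<in> F. axis_dist w + k * translation_length w \<le> cp y (w [^] k) \<or>
     axis_dist w + k * translation_length w \<le> cp y (inv w [^] k)}"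

lemma near_ends_Suc:
  assumes w: "w \<in> F" "w \<noteq> \<one>" and k: "1 \<le> k"
  shows "near_ends w (Suc k) \<subseteq> near_ends w k"
proof -
  have iw: "inv w \<in> F" "inv w \<noteq> \<one>" using w inv_eq_1_iff by auto
  have *: "axis_dist v + k * translation_length v \<le> cp y (v [^] k)"
    if "axis_dist v + Suc k * translation_length v \<le> cp y (v [^] Suc k)" "v \<in> F" "v \<noteq> \<one>" for v y
    using that cp_pow[OF that(2,3) k, of "Suc k"]
    by - (rule cp_ultra[of _ _ "v [^] Suc k"], auto simp: cp_commute simp del: nat_pow_Suc)
  show ?thesis using *[of w] *[of "inv w"] w iw
    by (auto simp: near_ends_def simp del: nat_pow_Suc mult_Suc)
qed

text \<open>Half of the exponent \<open>2 * k\<close> is spent on leaving the repelling end, the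
  other half on coming close to the attracting one.\<close>

lemma pow_moves_into_near_ends:
  assumes w: "w \<in> F" "w \<noteq> \<one>" and k: "1 \<le> k" and y: "y \<in> F" "y \<notin> near_ends w k"
  shows "w [^] (2 * k) \<otimes> y \<in> near_ends w k"
proof -
  have "axis_dist w + (2 * k - k) * translation_length w < cp (w [^] (2 * k) \<otimes> y) (w [^] (2 * k))"
    by (rule cp_pow_mult[OF w y(1) k]) (use y in \<open>auto simp: near_ends_def not_le\<close>)
  then have "axis_dist w + k * translation_length w \<le> cp (w [^] (2 * k) \<otimes> y) (w [^] k)"
    using cp_pow[OF w k, of "2 * k"]
    by - (rule cp_ultra[of _ _ "w [^] (2 * k)"], auto simp: cp_commute)
  then show ?thesis using w y by (simp add: near_ends_def)
qed

text \<open>Left multiplication by \<open>x\<close> is an isometry of the tree that moves the base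
  point by \<open>len x\<close>, and a Gromov product changes by at most this distance.\<close>

lemma cp_left_mult:
  assumes x: "x \<in> F" and y: "y \<in> F" and z: "z \<in> F"
  shows "cp y z \<le> cp (x \<otimes> y) (x \<otimes> z) + len x"
proof -
  have *: "len v \<le> len (x \<otimes> v) + len x" if "v \<in> F" for v
    using len_mult[of "inv x" "x \<otimes> v"] x that by (simp add: inv_mult_cancel)
  have "inv (x \<otimes> y) \<otimes> (x \<otimes> z) = inv y \<otimes> z"
    using x y z by (simp add: inv_mult_group m_assoc inv_mult_cancel)
  then show ?thesis
    using len_inv_mult[of y z] len_inv_mult[of "x \<otimes> y" "x \<otimes> z"] *[of y] *[of z] x y z by simp
qed

text \<open>Overlaps at arbitrary depth mean that \<open>x\<close> takes the attracting end of
  \<open>w\<close> to that of \<open>v\<close>. Then \<open>x \<otimes> w [^] k\<close> and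
  \<open>v [^] k\<close> stay at bounded distance, so by finiteness of balls two of the quotients
  \<open>t k\<close> coincide, which yields the relation.\<close>

lemma near_ends_overlap_same:
  assumes w: "w \<in> F" "w \<noteq> \<one>" and v: "v \<in> F" "v \<noteq> \<one>"
    and eq: "axis_dist v = axis_dist w" "translation_length v = translation_length w"
    and x: "x \<in> F"
    and inf: "infinite {k. 1 \<le> k \<and> (\<exists>z\<in>F. axis_dist w + k * translation_length w \<le> cp z (w [^] k) \<and>
        axis_dist w + k * translation_length w \<le> cp (x \<otimes> z) (v [^] k))}" (is "infinite ?K")
  shows "\<exists>n\<ge>1. x \<otimes> w [^] (n::nat) = v [^] n \<otimes> x"
proof -
  define t where "t k = inv (v [^] (k::nat)) \<otimes> (x \<otimes> w [^] k)" for k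
  have tF: "t k \<in> F" for k using w v x by (simp add: t_def)
  have "len (t k) \<le> 2 * axis_dist w + 3 * len x" if kK: "k \<in> ?K" for k
  proof -
    obtain z where k: "1 \<le> k" and z: "z \<in> F" "axis_dist w + k * translation_length w \<le> cp z (w [^] k)"
      "axis_dist w + k * translation_length w \<le> cp (x \<otimes> z) (v [^] k)" using kK by blast
    define m where "m = axis_dist w + k * translation_length w - len x"
    have "m \<le> cp (x \<otimes> z) (x \<otimes> w [^] k)"
      using cp_left_mult[OF x z(1), of "w [^] k"] z w by (simp add: m_def)
    moreover have "m \<le> cp (x \<otimes> z) (v [^] k)" using z by (simp add: m_def)
    ultimately have "m \<le> cp (v [^] k) (x \<otimes> w [^] k)"
      by - (rule cp_ultra[of _ _ "x \<otimes> z"], auto simp: cp_commute)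
    moreover have "len (t k) + 2 * cp (v [^] k) (x \<otimes> w [^] k) = len (v [^] k) + len (x \<otimes> w [^] k)"
      unfolding t_def using w v x by (intro len_inv_mult) auto
    moreover have "len (x \<otimes> w [^] k) \<le> len x + len (w [^] k)"
      using len_mult[OF x, of "w [^] k"] w by simp
    ultimately show ?thesis
      using len_pow[OF w k] len_pow[OF v k] eq by (simp add: m_def)
  qed
  then have "t ` ?K \<subseteq> {y \<in> F. len y \<le> 2 * axis_dist w + 3 * len x}" using tF by blast
  then have "finite (t ` ?K)" using finite_len_le finite_subset by blast
  then have "\<not> inj_on t ?K" using inf finite_imageD by blast
  then obtain k l where kl: "t k = t l" "k < l" unfolding inj_on_def by (metis linorder_neqE_nat)
  have eq': "x \<otimes> w [^] k = v [^] k \<otimes> t k" for k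
    using w v x by (simp add: t_def inv_mult_cancel)
  have "v [^] k \<otimes> (v [^] (l - k) \<otimes> t l) = v [^] l \<otimes> t l"
    using kl v tF by (simp add: nat_pow_mult flip: m_assoc)
  also have "\<dots> = x \<otimes> w [^] k \<otimes> w [^] (l - k)"
    using kl w x by (simp add: m_assoc nat_pow_mult eq'[symmetric])
  also have "\<dots> = v [^] k \<otimes> (t k \<otimes> w [^] (l - k))"
    using w v x tF by (simp add: eq' m_assoc)
  finally have 1: "v [^] (l - k) \<otimes> t k = t k \<otimes> w [^] (l - k)"
    using kl v w tF by simp
  show ?thesis
  proof (intro exI[of _ "l - k"] conjI)
    have com: "v [^] k \<otimes> v [^] (l - k) = v [^] (l - k) \<otimes> v [^] k"
      and com': "w [^] k \<otimes> w [^] (l - k) = w [^] (l - k) \<otimes> w [^] k"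
      using v w by (simp_all add: nat_pow_mult add.commute)
    \<comment> \<open>\<open>x\<close> and \<open>t k\<close> differ by the factors
      \<open>v [^] k\<close> and \<open>w [^] k\<close>, which commute with the
      \<open>(l - k)\<close>-th powers, so the relation for \<open>t k\<close> passes to
      \<open>x\<close>.\<close>
    have "x \<otimes> w [^] (l - k) \<otimes> w [^] k = v [^] k \<otimes> t k \<otimes> w [^] (l - k)"
      using w v x tF by (simp add: m_assoc eq'[symmetric] com'[symmetric])
    also have "\<dots> = v [^] k \<otimes> (v [^] (l - k) \<otimes> t k)" using 1 v w tF by (simp add: m_assoc)
    also have "\<dots> = v [^] (l - k) \<otimes> (v [^] k \<otimes> t k)" using com v tF by (simp flip: m_assoc)
    also have "\<dots> = v [^] (l - k) \<otimes> x \<otimes> w [^] k" using v w x tF by (simp add: m_assoc eq')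
    finally show "x \<otimes> w [^] (l - k) = v [^] (l - k) \<otimes> x"
      using w v x by simp
  qed (use kl in simp)
qed

text \<open>Each overlap matches one end of \<open>w\<close> with one end, and one of the four cases
  occurs at infinitely many depths. If the end is kept, \<open>x\<close> centralises a power of
  \<open>w\<close>; if the ends are interchanged, \<open>x\<close> inverts it.\<close>

lemma near_ends_overlap:
  assumes w: "w \<in> F" "w \<noteq> \<one>" and x: "x \<in> F"
    and inf: "infinite {k. \<exists>z\<in>near_ends w k. x \<otimes> z \<in> near_ends w k}"
  shows "\<exists>n\<ge>1. x \<otimes> w [^] (n::nat) = w [^] n \<otimes> x \<or> x \<otimes> w [^] n = inv (w [^] n) \<otimes> x"
proof -
  have iw: "inv w \<in> F" "inv w \<noteq> \<one>" using w inv_eq_1_iff by auto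
  define K where "K v v' = {k. 1 \<le> k \<and> (\<exists>z\<in>F. axis_dist w + k * translation_length w \<le> cp z (v [^] k) \<and>
        axis_dist w + k * translation_length w \<le> cp (x \<otimes> z) (v' [^] k))}" for v v'
  have "{k. \<exists>z\<in>near_ends w k. x \<otimes> z \<in> near_ends w k} \<subseteq>
      {0} \<union> K w w \<union> K w (inv w) \<union> K (inv w) w \<union> K (inv w) (inv w)"
    by (auto simp: near_ends_def K_def Suc_le_eq)
  then have "infinite ({0} \<union> K w w \<union> K w (inv w) \<union> K (inv w) w \<union> K (inv w) (inv w))"
    using inf finite_subset by blast
  then consider "infinite (K w w)" | "infinite (K w (inv w))" | "infinite (K (inv w) w)"
    | "infinite (K (inv w) (inv w))"
    by auto
  then show ?thesis
  proof cases
    case 1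
    then show ?thesis using near_ends_overlap_same[OF w w _ _ x] unfolding K_def by blast
  next
    case 2
    then have "\<exists>n\<ge>1. x \<otimes> w [^] (n::nat) = inv w [^] n \<otimes> x"
      unfolding K_def by (intro near_ends_overlap_same[OF w iw _ _ x]) (use w in auto)
    then show ?thesis using w by (auto simp: inv_pow)
  next
    case 3
    then have "\<exists>n\<ge>1. x \<otimes> inv w [^] (n::nat) = w [^] n \<otimes> x"
      unfolding K_def by (intro near_ends_overlap_same[OF iw w _ _ x]) (use w in auto)
    then obtain n :: nat where n: "n \<ge> 1" "x \<otimes> inv (w [^] n) = w [^] n \<otimes> x"
      using w by (auto simp: inv_pow)
    have "x \<otimes> w [^] n = inv (w [^] n) \<otimes> (w [^] n \<otimes> x) \<otimes> w [^] n"
      using w x by (simp add: inv_mult_cancel)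
    also have "\<dots> = inv (w [^] n) \<otimes> (x \<otimes> inv (w [^] n)) \<otimes> w [^] n" by (simp only: n(2))
    also have "\<dots> = inv (w [^] n) \<otimes> x" using w x by (simp add: m_assoc)
    finally show ?thesis using n by blast
  next
    case 4
    then have "\<exists>n\<ge>1. x \<otimes> inv w [^] (n::nat) = inv w [^] n \<otimes> x"
      unfolding K_def by (intro near_ends_overlap_same[OF iw iw _ _ x]) (use w in auto)
    then obtain n :: nat where n: "n \<ge> 1" "x \<otimes> inv (w [^] n) = inv (w [^] n) \<otimes> x"
      using w by (auto simp: inv_pow)
    have "x \<otimes> w [^] n = w [^] n \<otimes> (inv (w [^] n) \<otimes> x) \<otimes> w [^] n"
      using w x by (simp add: inv_mult_cancel)
    also have "\<dots> = w [^] n \<otimes> (x \<otimes> inv (w [^] n)) \<otimes> w [^] n" by (simp only: n(2))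
    also have "\<dots> = w [^] n \<otimes> x" using w x by (simp add: m_assoc)
    finally show ?thesis using n by blast
  qed
qed

section \<open>Commutation and conjugation in a free group\<close>

lemma rf_basis_pow:
  assumes a: "a \<in> X"
  shows "rf (a [^] (p::nat)) = replicate p (a, True)"
proof -
  have "successively (\<lambda>p q. \<not> cancelling p q) (replicate p (a, True))"
  proof (induction p)
    case (Suc p)
    then show ?case by (cases p) (simp_all add: cancelling_def)
  qed simp
  then have r: "replicate p (a, True) \<in> reduced_words X"
    using a by (auto simp: reduced_words_def)
  have "word_value H (replicate p (a, True)) = a [^] p"
  proof (induction p)
    case (Suc p)
    then show ?case using nat_pow_Suc2[of a p] a by (simp add: word_value_Cons letter_value_def)
  qed simp
  then show ?thesis using rf_word_value[OF r] by simp
qed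

text \<open>Nothing cancels in \<open>a [^] p \<otimes> z\<close>, so it begins with
  \<open>a\<close>. As its length is additive, being equal to \<open>z \<otimes> a [^] p\<close>
  would make it begin with the first letter of \<open>z\<close> as well.\<close>

lemma basis_pow_not_commute:
  assumes a: "a \<in> X" and z: "z \<in> F" "z \<noteq> \<one>" and first: "fst (hd (rf z)) \<noteq> a" and p: "1 \<le> p"
  shows "a [^] (p::nat) \<otimes> z \<noteq> z \<otimes> a [^] p"
proof
  assume eq: "a [^] p \<otimes> z = z \<otimes> a [^] p"
  have aF: "a [^] p \<in> F" using a by blast
  have ne: "rf z \<noteq> []" using z len_eq_0_iff[of z] by (simp add: len_def)
  have far: "cp y z = 0" if "y \<in> F" "rf y \<noteq> []" "fst (hd (rf y)) = a" for y
  proof (rule ccontr)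
    assume "cp y z \<noteq> 0"
    then have "1 \<le> cp y z" by simp
    then have "take 1 (rf y) = take 1 (rf z)" by (simp add: le_cp_iff)
    then show False using that first ne by (cases "rf y"; cases "rf z") auto
  qed
  have lp: "len (a [^] p) = p" using rf_basis_pow[OF a] by (simp add: len_def)
  have i: "cp (inv (a [^] p)) z = 0"
    by (rule far) (use a aF p rf_basis_pow[OF a, of p] in \<open>auto simp: rf_inv formal_inverse_def hd_map hd_replicate\<close>)
  then have l1: "len (a [^] p \<otimes> z) = p + len z"
    using len_mult[OF aF z(1)] lp by simp
  have "inv (a [^] p \<otimes> z) \<otimes> a [^] p = inv z" using aF z by (simp add: inv_mult_group m_assoc)
  then have "1 \<le> cp (a [^] p \<otimes> z) (a [^] p)"
    using len_inv_mult[of "a [^] p \<otimes> z" "a [^] p"] aF z l1 lp p by simp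
  moreover have "1 \<le> cp z (a [^] p \<otimes> z)"
  proof -
    have "inv z \<otimes> (a [^] p \<otimes> z) = a [^] p" unfolding eq using aF z by (simp add: inv_mult_cancel)
    then show ?thesis using len_inv_mult[of z "a [^] p \<otimes> z"] aF z l1 lp ne
      by (cases "rf z") (simp_all add: len_def)
  qed
  ultimately have "1 \<le> cp z (a [^] p)" using cp_ultra by blast
  moreover have "cp (a [^] p) z = 0"
    by (rule far) (use aF p rf_basis_pow[OF a, of p] in \<open>auto simp: hd_replicate\<close>)
  ultimately show False by (simp add: cp_commute)
qed

text \<open>Removing \<open>x\<close> on the left leaves \<open>u \<otimes> inv x\<close>, which is
  not much longer than \<open>x\<close>. A long conjugate thus shares a long prefix with
  \<open>x\<close>; in this way convergence passes from the conjugates to the conjugators.\<close>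

lemma len_conjugate_le:
  assumes x: "x \<in> F" and u: "u \<in> F"
  shows "len (x \<otimes> u \<otimes> inv x) \<le> len u + 2 * cp x (x \<otimes> u \<otimes> inv x)"
proof -
  have "inv x \<otimes> (x \<otimes> u \<otimes> inv x) = u \<otimes> inv x" using x u by (simp add: m_assoc inv_mult_cancel)
  then have "len (u \<otimes> inv x) + 2 * cp x (x \<otimes> u \<otimes> inv x) = len x + len (x \<otimes> u \<otimes> inv x)"
    using len_inv_mult[of x "x \<otimes> u \<otimes> inv x"] x u by simp
  moreover have "len (u \<otimes> inv x) \<le> len u + len x" using len_mult[of u "inv x"] x u by simp
  ultimately show ?thesis by simp
qed

text \<open>Translation length is the growth rate of \<open>len (w [^] k)\<close> in
  \<open>k\<close>, and conjugation by \<open>x\<close> changes these lengths by at most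
  \<open>2 * len x\<close>.\<close>

lemma translation_length_conjugate_le:
  assumes u: "u \<in> F" "u \<noteq> \<one>" and x: "x \<in> F"
  shows "translation_length (x \<otimes> u \<otimes> inv x) \<le> translation_length u"
proof (rule ccontr)
  define w where "w = x \<otimes> u \<otimes> inv x"
  assume "\<not> ?thesis"
  then have less: "Suc (translation_length u) \<le> translation_length w" by (simp add: w_def)
  have w: "w \<in> F" using u x by (simp add: w_def)
  have "w \<noteq> \<one>"
  proof
    assume "w = \<one>"
    then have "inv x \<otimes> (x \<otimes> u \<otimes> inv x) \<otimes> x = \<one>" using x by (simp add: w_def)
    then show False using u x by (simp add: m_assoc inv_mult_cancel)
  qed
  \<comment> \<open>Large enough for a difference of one between the translation lengths to outweigh
    the bounded terms.\<close>
  define k where "k = Suc (2 * len x + 2 * axis_dist u)"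
  have pow: "w [^] n = x \<otimes> u [^] n \<otimes> inv x" for n :: nat
  proof (induction n)
    case (Suc n)
    then show ?case using u x by (simp add: w_def m_assoc inv_mult_cancel)
  qed (use x in simp)
  have tri: "len (y \<otimes> z) \<le> len y + len z" if "y \<in> F" "z \<in> F" for y z
    using len_mult[OF that] by simp
  have "len (w [^] k) \<le> len x + len (u [^] k) + len x"
    using tri[of "x \<otimes> u [^] k" "inv x"] tri[of x "u [^] k"] x u by (simp add: pow)
  then have "k * translation_length w \<le> 2 * len x + 2 * axis_dist u + k * translation_length u"
    using len_pow[OF w \<open>w \<noteq> \<one>\<close>, of k] len_pow[OF u, of k] by (simp add: k_def)
  moreover have "k * Suc (translation_length u) \<le> k * translation_length w"
    using less by (rule mult_le_mono2)
  ultimately show False by (simp add: k_def)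
qed

section \<open>Convergence to a boundary point\<close>

text \<open>The stabilised prefixes are compatible and reduced, hence are the initial segments of
  one reduced ray; agreement up to length \<open>n\<close> means distance at most
  \<open>1 / (n + 1)\<close>.\<close>

lemma limitin_hyp_boundary:
  assumes x: "\<And>i. x i \<in> F"
    and ev: "\<And>n. \<exists>v. \<forall>\<^sub>F i in sequentially. n \<le> len (x i) \<and> take n (rf (x i)) = v"
  shows "\<exists>w\<in>hyp_boundary X.
    limitin (hyp_topology X) (\<lambda>i. Fin_word (reduced_form H X (x i))) w sequentially"
proof -
  obtain v where v: "\<And>n. \<forall>\<^sub>F i in sequentially. n \<le> len (x i) \<and> take n (rf (x i)) = v n"
    using ev by metis
  have v_take: "take n (v m) = v n \<and> length (v n) = n \<and> v n \<in> reduced_words X" if "n \<le> m" for n m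
  proof -
    obtain i where i: "n \<le> len (x i)" "take n (rf (x i)) = v n" "m \<le> len (x i)" "take m (rf (x i)) = v m"
      using eventually_happens[OF eventually_conj[OF v[of n] v[of m]]] by auto
    have "take n (v m) = v n" using i(2) that by (simp flip: i(4))
    moreover have "take n (rf (x i)) \<in> reduced_words X"
    proof -
      have "take n (rf (x i)) @ drop n (rf (x i)) \<in> reduced_words X" using rf_reduced[OF x] by simp
      then show ?thesis unfolding reduced_words_def
        by (simp del: append_take_drop_id add: successively_append_iff image_Un)
    qed
    moreover have "length (v n) = n" using i(1) by (simp add: len_def flip: i(2))
    ultimately show ?thesis using i(2) by simp
  qed
  define r where "r n = v (Suc n) ! n" for n
  have r_nth: "v n ! j = r j" if "j < n" for j n
  proof -
    have "take (Suc j) (v n) = v (Suc j)" using v_take[of "Suc j" n] that by simp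
    then show ?thesis using nth_take[of j "Suc j" "v n"] by (simp add: r_def)
  qed
  have r_map: "map r [0..<n] = v n" for n
    by (rule nth_equalityI) (use v_take[of n n] r_nth in auto)
  have "r \<in> reduced_rays X"
    unfolding reduced_rays_def
  proof (intro CollectI conjI allI)
    fix n
    have red: "v (Suc (Suc n)) \<in> reduced_words X" using v_take by blast
    have eq: "v (Suc (Suc n)) = v n @ [r n, r (Suc n)]" by (simp flip: r_map)
    show "fst (r n) \<in> X" "\<not> cancelling (r n) (r (Suc n))"
      using red unfolding eq by (auto simp: reduced_words_def successively_append_iff)
  qed
  then have w: "Inf_word r \<in> hyp_boundary X" by (simp add: hyp_boundary_def)
  interpret Metric_space "hyp_compactification X" word_dist by (rule Metric_space_word_dist)
  have "limitin (hyp_topology X) (\<lambda>i. Fin_word (reduced_form H X (x i))) (Inf_word r) sequentially"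
    unfolding hyp_topology_def limitin_metric
  proof (intro conjI allI impI)
    show "Inf_word r \<in> hyp_compactification X" using w by (simp add: hyp_compactification_def)
    fix e :: real assume "0 < e"
    then obtain n :: nat where n: "1 / (real n + 1) < e"
      by (metis nat_approx_posE of_nat_Suc add.commute)
    show "\<forall>\<^sub>F i in sequentially. Fin_word (reduced_form H X (x i)) \<in> hyp_compactification X \<and>
        word_dist (Fin_word (reduced_form H X (x i))) (Inf_word r) < e"
      using v[of n]
    proof eventually_elim
      case (elim i)
      have "has_prefix (Fin_word (rf (x i))) (v n)" using elim take_is_prefix[of n "rf (x i)"] by simp
      moreover have "has_prefix (Inf_word r) (v n)" using r_map v_take[of n n] by simp
      ultimately have "length (v n) \<le> common_prefix_length (Fin_word (rf (x i))) (Inf_word r)"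
        by (intro common_prefix_length_ge) auto
      then have "n \<le> common_prefix_length (Fin_word (rf (x i))) (Inf_word r)" using v_take[of n n] by simp
      then have "word_dist (Fin_word (rf (x i))) (Inf_word r) \<le> 1 / (real n + 1)"
        by (simp add: word_dist_def divide_left_mono)
      then show ?case using n rf_reduced[OF x] by (auto simp: rf_def hyp_compactification_def)
    qed
  qed
  then show ?thesis using w by blast
qed

end

section \<open>Stationary means and harmonic functions\<close>

locale group_walk = group H for H :: "('a, 'b) monoid_scheme" (structure) +
  fixes \<mu> :: "'a pmf"
  assumes countable_carrier: "countable (carrier H)"
    and nondegenerate: "nondegenerate H \<mu>"
begin

lemma step_closed [simp, intro]: "g \<in> set_pmf \<mu> \<Longrightarrow> g \<in> carrier H"
  using nondegenerate by (auto simp: nondegenerate_def)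

lemma span_step: "semigroup_span H (set_pmf \<mu>) = carrier H"
  using nondegenerate by (auto simp: nondegenerate_def)

lemma integrable_bounded:
  fixes f :: "'a \<Rightarrow> real"
  assumes "\<And>g. g \<in> carrier H \<Longrightarrow> \<bar>f g\<bar> \<le> b"
  shows "integrable (measure_pmf \<mu>) f"
  by (rule measure_pmf.integrable_const_bound[where B = b])
     (use assms in \<open>auto simp: AE_measure_pmf_iff\<close>)

lemma integrable_bounded_step:
  fixes f :: "'a \<Rightarrow> real"
  assumes "\<And>g. g \<in> carrier H \<Longrightarrow> \<bar>f g\<bar> \<le> b" and "h \<in> carrier H"
  shows "integrable (measure_pmf \<mu>) (\<lambda>g. f (h \<otimes> g))"
  by (rule integrable_bounded[of _ b]) (use assms in auto)

lemma step_integral_tendsto: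
  fixes f :: "nat \<Rightarrow> 'a \<Rightarrow> real"
  assumes bound: "\<And>n g. g \<in> carrier H \<Longrightarrow> \<bar>f n g\<bar> \<le> b"
    and lim: "\<And>g. g \<in> carrier H \<Longrightarrow> (\<lambda>n. f n g) \<longlonglongrightarrow> f' g"
  shows "(\<lambda>n. \<integral>g. f n g \<partial>measure_pmf \<mu>) \<longlonglongrightarrow> (\<integral>g. f' g \<partial>measure_pmf \<mu>)"
  by (rule integral_dominated_convergence[where w = "\<lambda>_. b"])
     (use assms in \<open>auto simp: AE_measure_pmf_iff\<close>)

section \<open>Laws of the walk and their Cesaro averages\<close>

text \<open>The distribution of a product of \<open>n\<close> independent steps. A new factor enters
  on the left, so that \<open>visit_Suc\<close> conditions on the first step.\<close>

primrec law :: "nat \<Rightarrow> 'a pmf" where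
  "law 0 = return_pmf \<one>"
| "law (Suc n) = bind_pmf \<mu> (\<lambda>g. map_pmf (\<lambda>r. g \<otimes> r) (law n))"

lemma law_closed: "r \<in> set_pmf (law n) \<Longrightarrow> r \<in> carrier H"
  by (induction n arbitrary: r) auto

definition visit :: "nat \<Rightarrow> 'a set \<Rightarrow> 'a \<Rightarrow> real" where
  "visit n B h = measure_pmf.prob (law n) {r. h \<otimes> r \<in> B}"

lemma visit_bounds: "0 \<le> visit n B h" "visit n B h \<le> 1"
  by (simp_all add: visit_def)

lemma visit_Suc:
  assumes h: "h \<in> carrier H"
  shows "visit (Suc n) B h = (\<integral>g. visit n B (h \<otimes> g) \<partial>measure_pmf \<mu>)"
proof -
  have "ennreal (visit (Suc n) B h) = (\<integral>\<^sup>+g. emeasure (law n) {r. h \<otimes> (g \<otimes> r) \<in> B} \<partial>measure_pmf \<mu>)"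
    by (simp add: visit_def vimage_def flip: measure_pmf.emeasure_eq_measure)
  also have "\<dots> = (\<integral>\<^sup>+g. ennreal (visit n B (h \<otimes> g)) \<partial>measure_pmf \<mu>)"
  proof (rule nn_integral_cong_AE, unfold AE_measure_pmf_iff, intro ballI)
    fix g assume g: "g \<in> set_pmf \<mu>"
    show "emeasure (law n) {r. h \<otimes> (g \<otimes> r) \<in> B} = ennreal (visit n B (h \<otimes> g))"
      unfolding visit_def measure_pmf.emeasure_eq_measure[symmetric]
      by (rule emeasure_eq_AE) (use g h law_closed in \<open>auto simp: AE_measure_pmf_iff m_assoc\<close>)
  qed
  also have "\<dots> = ennreal (\<integral>g. visit n B (h \<otimes> g) \<partial>measure_pmf \<mu>)"
    by (rule nn_integral_eq_integral)
       (use h in \<open>auto intro!: integrable_bounded_step[of _ 1] simp: visit_bounds\<close>)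
  finally show ?thesis by (simp add: visit_bounds integral_nonneg_AE)
qed

definition visit_mean :: "nat \<Rightarrow> 'a set \<Rightarrow> 'a \<Rightarrow> real" where
  "visit_mean n B h = (\<Sum>i<Suc n. visit i B h) / real (Suc n)"

lemma visit_mean_bounds: "0 \<le> visit_mean n B h" "visit_mean n B h \<le> 1"
proof -
  show "0 \<le> visit_mean n B h" by (simp add: visit_mean_def visit_bounds sum_nonneg add_nonneg_nonneg)
  have "(\<Sum>i<Suc n. visit i B h) \<le> (\<Sum>i<Suc n. 1)" by (rule sum_mono) (rule visit_bounds)
  then show "visit_mean n B h \<le> 1" by (simp add: visit_mean_def)
qed

text \<open>The averages are harmonic up to a telescoped remainder of order \<open>1 / n\<close>,
  which disappears in the limit.\<close>

lemma visit_mean_step: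
  assumes h: "h \<in> carrier H"
  shows "(\<integral>g. visit_mean n B (h \<otimes> g) \<partial>measure_pmf \<mu>) =
    visit_mean n B h + (visit (Suc n) B h - visit 0 B h) / real (Suc n)"
proof -
  have "(\<integral>g. visit_mean n B (h \<otimes> g) \<partial>measure_pmf \<mu>) = (\<Sum>i<Suc n. visit (Suc i) B h) / real (Suc n)"
    unfolding visit_mean_def visit_Suc[OF h]
    by (subst integral_divide_zero, subst Bochner_Integration.integral_sum)
       (use h in \<open>auto intro!: integrable_bounded_step[of _ 1] simp: visit_bounds\<close>)
  also have "(\<Sum>i<Suc n. visit (Suc i) B h) = (\<Sum>i<Suc n. visit i B h) + (visit (Suc n) B h - visit 0 B h)"
    using sum_lessThan_telescope[of "\<lambda>i. visit i B h" "Suc n"] by (simp add: sum_subtractf)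
  finally show ?thesis by (simp add: visit_mean_def add_divide_distrib)
qed

text \<open>Linear inequalities between translated indicators survive integration, and then
  averaging and limits. Monotonicity, packing and covering estimates for the mean are all instances
  of this schema.\<close>

lemma visit_linear_le:
  assumes fin: "finite I" and h: "\<And>i. i \<in> I \<Longrightarrow> h i \<in> carrier H"
    and le: "\<And>g. g \<in> carrier H \<Longrightarrow> (\<Sum>i\<in>I. c i * indicator (B i) (h i \<otimes> g)) \<le> (b::real)"
  shows "(\<Sum>i\<in>I. c i * visit n (B i) (h i)) \<le> b"
proof -
  have int: "integrable (measure_pmf (law n)) (\<lambda>r. indicat_real (B i) (h i \<otimes> r))" for i
    by (rule measure_pmf.integrable_const_bound[where B = 1]) auto
  have v: "visit n (B i) (h i) = (\<integral>r. indicat_real (B i) (h i \<otimes> r) \<partial>measure_pmf (law n))" for i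
  proof -
    have "(\<lambda>r. indicat_real (B i) (h i \<otimes> r)) = indicat_real {r. h i \<otimes> r \<in> B i}"
      by (auto simp: indicator_def)
    then show ?thesis by (simp add: visit_def)
  qed
  have "(\<Sum>i\<in>I. c i * visit n (B i) (h i)) =
      (\<integral>r. (\<Sum>i\<in>I. c i * indicat_real (B i) (h i \<otimes> r)) \<partial>measure_pmf (law n))"
    unfolding v by (subst Bochner_Integration.integral_sum) (use int in auto)
  also have "\<dots> \<le> b"
    by (rule measure_pmf.integral_le_const) (use int le law_closed in \<open>auto simp: AE_measure_pmf_iff\<close>)
  finally show ?thesis .
qed

lemma visit_mean_linear_le:
  assumes fin: "finite I" and h: "\<And>i. i \<in> I \<Longrightarrow> h i \<in> carrier H"
    and le: "\<And>g. g \<in> carrier H \<Longrightarrow> (\<Sum>i\<in>I. c i * indicator (B i) (h i \<otimes> g)) \<le> (b::real)"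
  shows "(\<Sum>i\<in>I. c i * visit_mean n (B i) (h i)) \<le> b"
proof -
  have "(\<Sum>i\<in>I. c i * visit_mean n (B i) (h i)) = (\<Sum>i\<in>I. \<Sum>j<Suc n. c i * visit j (B i) (h i)) / real (Suc n)"
    unfolding visit_mean_def sum_divide_distrib[of _ I] by (simp only: sum_distrib_left times_divide_eq_right)
  also have "\<dots> = (\<Sum>j<Suc n. \<Sum>i\<in>I. c i * visit j (B i) (h i)) / real (Suc n)"
    by (subst sum.swap) simp
  also have "\<dots> \<le> (\<Sum>j<Suc n. b) / real (Suc n)"
    by (intro divide_right_mono sum_mono visit_linear_le assms) auto
  finally show ?thesis by simp
qed

section \<open>Harmonic functions and the Harnack inequality\<close>

definition harmonic :: "('a \<Rightarrow> real) \<Rightarrow> bool" where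
  "harmonic f \<longleftrightarrow> (\<forall>h\<in>carrier H. f h = (\<integral>g. f (h \<otimes> g) \<partial>measure_pmf \<mu>))"

text \<open>\<open>f B h\<close> plays the role of \<open>\<nu> (h\<inverse> B)\<close> for a \<open>\<mu>\<close>-stationary mean \<open>\<nu>\<close> on \<open>H\<close>.\<close>

lemma stationary_mean_exists:
  assumes C: "countable \<C>"
  obtains f :: "'a set \<Rightarrow> 'a \<Rightarrow> real" where
    "\<And>B. B \<in> \<C> \<Longrightarrow> harmonic (f B)"
    "\<And>I h B c b. finite I \<Longrightarrow> (\<And>i::nat. i \<in> I \<Longrightarrow> h i \<in> carrier H) \<Longrightarrow> (\<And>i. i \<in> I \<Longrightarrow> B i \<in> \<C>) \<Longrightarrow>
      (\<And>g. g \<in> carrier H \<Longrightarrow> (\<Sum>i\<in>I. c i * indicator (B i) (h i \<otimes> g)) \<le> (b::real)) \<Longrightarrow>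
      (\<Sum>i\<in>I. c i * f (B i) (h i)) \<le> b"
proof -
  \<comment> \<open>Diagonal argument: the averages are bounded by one, and only countably many
    pairs of a set in \<open>\<C>\<close> and a group element have to converge.\<close>
  obtain k :: "nat \<Rightarrow> nat" where k: "strict_mono k"
    and lim: "\<And>x. x \<in> \<C> \<times> carrier H \<Longrightarrow> \<exists>l. (\<lambda>n. visit_mean (k n) (fst x) (snd x)) \<longlonglongrightarrow> l"
    using function_convergent_subsequence[of "\<C> \<times> carrier H" "\<lambda>n x. visit_mean n (fst x) (snd x)" 1]
      C countable_carrier visit_mean_bounds by auto
  define f where "f B h = lim (\<lambda>n. visit_mean (k n) B h)" for B h
  have f: "(\<lambda>n. visit_mean (k n) B h) \<longlonglongrightarrow> f B h" if "B \<in> \<C>" "h \<in> carrier H" for B h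
    using lim[of "(B, h)"] that by (auto simp: f_def limI)
  show thesis
  proof (rule that[of f])
    show "harmonic (f B)" if B: "B \<in> \<C>" for B
      unfolding harmonic_def
    proof
      fix h assume h: "h \<in> carrier H"
      have "(\<lambda>n. \<integral>g. visit_mean (k n) B (h \<otimes> g) \<partial>measure_pmf \<mu>) \<longlonglongrightarrow> (\<integral>g. f B (h \<otimes> g) \<partial>measure_pmf \<mu>)"
        by (rule step_integral_tendsto[of _ 1]) (use f B h visit_mean_bounds in auto)
      moreover have "(\<lambda>n. visit_mean (k n) B h + (visit (Suc (k n)) B h - visit 0 B h) / real (Suc (k n)))
          \<longlonglongrightarrow> f B h + 0"
      proof (rule tendsto_add[OF f[OF B h]])
        have "(\<lambda>n. (visit (Suc n) B h - visit 0 B h) / real (Suc n)) \<longlonglongrightarrow> 0"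
        proof (rule Lim_null_comparison)
          show "\<forall>\<^sub>F n in sequentially. norm ((visit (Suc n) B h - visit 0 B h) / real (Suc n)) \<le> inverse (real (Suc n))"
          proof (intro always_eventually allI)
            fix n
            have "\<bar>visit (Suc n) B h - visit 0 B h\<bar> \<le> 1"
              using visit_bounds[of "Suc n" B h] visit_bounds[of 0 B h] by linarith
            then show "norm ((visit (Suc n) B h - visit 0 B h) / real (Suc n)) \<le> inverse (real (Suc n))"
              by (simp add: abs_divide inverse_eq_divide divide_right_mono del: of_nat_Suc)
          qed
          show "(\<lambda>n. inverse (real (Suc n))) \<longlonglongrightarrow> 0" by (rule LIMSEQ_inverse_real_of_nat)
        qed
        from LIMSEQ_subseq_LIMSEQ[OF this k]
        show "(\<lambda>n. (visit (Suc (k n)) B h - visit 0 B h) / real (Suc (k n))) \<longlonglongrightarrow> 0" by (simp add: o_def)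
      qed
      ultimately show "f B h = (\<integral>g. f B (h \<otimes> g) \<partial>measure_pmf \<mu>)"
        using LIMSEQ_unique by (force simp: visit_mean_step[OF h])
    qed
    show "(\<Sum>i\<in>I. c i * f (B i) (h i)) \<le> b"
      if "finite I" "\<And>i::nat. i \<in> I \<Longrightarrow> h i \<in> carrier H" "\<And>i. i \<in> I \<Longrightarrow> B i \<in> \<C>"
        "\<And>g. g \<in> carrier H \<Longrightarrow> (\<Sum>i\<in>I. c i * indicator (B i) (h i \<otimes> g)) \<le> (b::real)" for I h B c b
    proof (rule LIMSEQ_le_const2)
      show "(\<lambda>n. \<Sum>i\<in>I. c i * visit_mean (k n) (B i) (h i)) \<longlonglongrightarrow> (\<Sum>i\<in>I. c i * f (B i) (h i))"
        by (intro tendsto_sum tendsto_mult tendsto_const f that)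
      show "\<exists>N. \<forall>n\<ge>N. (\<Sum>i\<in>I. c i * visit_mean (k n) (B i) (h i)) \<le> b"
        using visit_mean_linear_le that by blast
    qed
  qed
qed

text \<open>Keeping only the step \<open>s\<close> in the average gives
  \<open>pmf \<mu> s * q (h \<otimes> s) \<le> q h\<close>; every \<open>g\<close> is a product of
  steps, and the constants multiply. The constant depends on \<open>g\<close> alone, neither on
  \<open>q\<close> nor on \<open>h\<close>.\<close>

lemma harnack:
  assumes "g \<in> carrier H"
  shows "\<exists>\<delta>>0. \<forall>q. harmonic q \<longrightarrow> (\<forall>h\<in>carrier H. 0 \<le> q h \<and> q h \<le> 1) \<longrightarrow>
    (\<forall>h\<in>carrier H. \<delta> * q (h \<otimes> g) \<le> q h)"
proof -
  have "g \<in> semigroup_span H (set_pmf \<mu>)" using assms span_step by simp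
  then show ?thesis
  proof induction
    case (incl s)
    show ?case
    proof (intro exI[of _ "pmf \<mu> s"] conjI allI impI ballI)
      show "0 < pmf \<mu> s" using incl by (simp add: pmf_positive)
      fix q h assume q: "harmonic q" "\<forall>h\<in>carrier H. 0 \<le> q h \<and> q h \<le> 1" and h: "h \<in> carrier H"
      have "pmf \<mu> s * q (h \<otimes> s) = (\<integral>g. indicator {s} g * q (h \<otimes> s) \<partial>measure_pmf \<mu>)"
        by (simp add: measure_pmf_single)
      also have "\<dots> \<le> (\<integral>g. q (h \<otimes> g) \<partial>measure_pmf \<mu>)"
      proof (rule integral_mono_AE)
        show "integrable (measure_pmf \<mu>) (\<lambda>g. q (h \<otimes> g))"
          by (rule integrable_bounded_step[of _ 1]) (use q h in auto)
        show "AE g in measure_pmf \<mu>. indicator {s} g * q (h \<otimes> s) \<le> q (h \<otimes> g)"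
          using q h by (auto simp: AE_measure_pmf_iff indicator_def)
      qed (simp add: measure_pmf.emeasure_eq_measure)
      also have "\<dots> = q h" using q h by (simp add: harmonic_def)
      finally show "pmf \<mu> s * q (h \<otimes> s) \<le> q h" .
    qed
  next
    case (mult g g')
    then have gc: "g \<in> carrier H" "g' \<in> carrier H" by (simp_all add: span_step)
    obtain d where d: "0 < d" and dq: "\<forall>q. harmonic q \<longrightarrow> (\<forall>h\<in>carrier H. 0 \<le> q h \<and> q h \<le> 1) \<longrightarrow>
      (\<forall>h\<in>carrier H. d * q (h \<otimes> g) \<le> q h)"
      using mult.IH(1) by blast
    obtain d' where d': "0 < d'" and dq': "\<forall>q. harmonic q \<longrightarrow> (\<forall>h\<in>carrier H. 0 \<le> q h \<and> q h \<le> 1) \<longrightarrow>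
      (\<forall>h\<in>carrier H. d' * q (h \<otimes> g') \<le> q h)"
      using mult.IH(2) by blast
    show ?case
    proof (intro exI[of _ "d * d'"] conjI allI impI ballI)
      show "0 < d * d'" using d d' by simp
      fix q h assume q: "harmonic q" "\<forall>h\<in>carrier H. 0 \<le> q h \<and> q h \<le> 1" and h: "h \<in> carrier H"
      have "d * (d' * q (h \<otimes> g \<otimes> g')) \<le> d * q (h \<otimes> g)"
        using d dq' q h gc by (intro mult_left_mono) auto
      also have "\<dots> \<le> q h" using dq q h by blast
      finally show "d * d' * q (h \<otimes> (g \<otimes> g')) \<le> q h" using h gc by (simp add: m_assoc mult.assoc)
    qed
  qed
qed

text \<open>Near a maximum of a bounded harmonic function, Harnack's inequality for its difference from
  the supremum makes the function almost maximal at all nearby right translates.\<close>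

lemma harmonic_almost_max:
  assumes q: "harmonic q" "\<And>h. h \<in> carrier H \<Longrightarrow> 0 \<le> q h \<and> q h \<le> 1"
    and G: "finite G" "G \<subseteq> carrier H" and h0: "h0 \<in> carrier H" "0 < q h0"
  obtains h where "h \<in> carrier H" "\<And>g. g \<in> G \<Longrightarrow> q h0 / 2 < q (h \<otimes> g)"
proof -
  define s where "s = (SUP h\<in>carrier H. q h)"
  have bdd: "bdd_above (q ` carrier H)" using q by (auto intro!: bdd_aboveI[of _ 1])
  have le_s: "q h \<le> s" if "h \<in> carrier H" for h
    unfolding s_def by (rule cSUP_upper[OF that bdd])
  have s1: "s \<le> 1" unfolding s_def by (rule cSUP_least) (use q in auto)
  have s0: "0 < s" using le_s[OF h0(1)] h0 by simp
  have "\<forall>g\<in>G. \<exists>\<delta>>0. \<forall>h\<in>carrier H. \<delta> * (s - q (h \<otimes> g)) \<le> s - q h"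
  proof
    fix g assume "g \<in> G"
    then have "g \<in> carrier H" using G by blast
    moreover have "harmonic (\<lambda>h. s - q h)"
      unfolding harmonic_def
    proof
      fix h assume h: "h \<in> carrier H"
      have "(\<integral>g. s - q (h \<otimes> g) \<partial>measure_pmf \<mu>) = s - (\<integral>g. q (h \<otimes> g) \<partial>measure_pmf \<mu>)"
        by (subst Bochner_Integration.integral_diff)
           (use q h in \<open>auto intro!: integrable_bounded_step[of _ 1]\<close>)
      then show "s - q h = (\<integral>g. s - q (h \<otimes> g) \<partial>measure_pmf \<mu>)"
        using q h by (simp add: harmonic_def)
    qed
    moreover have "\<forall>h\<in>carrier H. 0 \<le> s - q h \<and> s - q h \<le> 1"
    proof
      fix h assume "h \<in> carrier H"
      then show "0 \<le> s - q h \<and> s - q h \<le> 1" using le_s[of h] q(2)[of h] s1 by auto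
    qed
    ultimately show "\<exists>\<delta>>0. \<forall>h\<in>carrier H. \<delta> * (s - q (h \<otimes> g)) \<le> s - q h"
      using harnack[of g] by blast
  qed
  then obtain d where d: "\<And>g. g \<in> G \<Longrightarrow> 0 < d g"
    "\<And>g h. g \<in> G \<Longrightarrow> h \<in> carrier H \<Longrightarrow> d g * (s - q (h \<otimes> g)) \<le> s - q h"
    by metis
  define e where "e = Min (insert 1 (d ` G))"
  have e0: "0 < e" using G d by (auto simp: e_def)
  have ed: "e \<le> d g" if "g \<in> G" for g using that G by (auto simp: e_def)
  \<comment> \<open>Within \<open>e * s / 2\<close> of the supremum at \<open>h\<close>, Harnack
    with the constant \<open>e\<close> keeps every translate by \<open>G\<close> within
    \<open>s / 2\<close> of it.\<close>
  have "s - e * s / 2 < s" using e0 s0 by simp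
  then obtain h where h: "h \<in> carrier H" "s - e * s / 2 < q h"
    unfolding s_def by (subst (asm) less_cSUP_iff[OF _ bdd]) auto
  show thesis
  proof (rule that[OF h(1)])
    fix g assume g: "g \<in> G"
    have "e * (s - q (h \<otimes> g)) \<le> d g * (s - q (h \<otimes> g))"
      using ed[OF g] le_s[of "h \<otimes> g"] g G h by (intro mult_right_mono) auto
    also have "\<dots> < e * (s / 2)" using d(2)[OF g h(1)] h(2) by simp
    finally have "s - q (h \<otimes> g) < s / 2" using e0 by simp
    then show "q h0 / 2 < q (h \<otimes> g)" using le_s[OF h0(1)] by simp
  qed
qed

end

section \<open>Harmonic functions along random paths\<close>

locale random_walk = group_walk +
  fixes P :: "(nat \<Rightarrow> 'a) measure"
  assumes walk_measure: "walk_measure H \<mu> P"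
begin

sublocale prob_space P
  using walk_measure by (simp add: walk_measure_def)

lemma sets_P: "sets P = sets (path_space H)"
  using walk_measure by (simp add: walk_measure_def)

lemma space_P: "space P = {\<tau>. range \<tau> \<subseteq> carrier H}"
  using sets_eq_imp_space_eq[OF sets_P] by (simp add: space_path_space)

lemma path_closed [simp]: "\<tau> \<in> space P \<Longrightarrow> \<tau> i \<in> carrier H"
  by (auto simp: space_P)

lemma measurable_coordinate [measurable]: "(\<lambda>\<tau>. \<tau> i) \<in> measurable P (count_space (carrier H))"
proof -
  have "(\<lambda>\<tau>. \<tau> i) \<in> measurable (path_space H) (count_space (carrier H))"
    unfolding path_space_def by (rule measurable_component_singleton) simp
  then show ?thesis unfolding measurable_cong_sets[OF sets_P refl] .
qed

lemma measurable_at [measurable]: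
  fixes \<phi> :: "'a \<Rightarrow> 'c::topological_space"
  shows "(\<lambda>\<tau>. \<phi> (\<tau> i)) \<in> borel_measurable P"
  by (rule measurable_compose[OF measurable_coordinate]) simp

lemma measurable_at2 [measurable]:
  fixes \<phi> :: "'a \<Rightarrow> 'a \<Rightarrow> 'c::topological_space"
  shows "(\<lambda>\<tau>. \<phi> (\<tau> i) (\<tau> j)) \<in> borel_measurable P"
  by (rule measurable_compose_countable'[OF _ measurable_coordinate countable_carrier]) simp

section \<open>The law of initial segments of a path\<close>

text \<open>The newest position comes first, so that a step of the walk is a \<open>Cons\<close> and
  the current position is the head, as in \<open>history_pmf\<close>.\<close>

definition history :: "nat \<Rightarrow> (nat \<Rightarrow> 'a) \<Rightarrow> 'a list" where
  "history n \<tau> = rev (map \<tau> [0..<Suc n])"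

lemma history_0: "history 0 \<tau> = [\<tau> 0]"
  and history_Suc: "history (Suc n) \<tau> = \<tau> (Suc n) # history n \<tau>"
  by (simp_all add: history_def)

lemma hd_history: "hd (history n \<tau>) = \<tau> n"
  by (cases n) (simp_all add: history_0 history_Suc)

lemma set_history: "set (history n \<tau>) = \<tau> ` {..n}"
  by (auto simp: history_def atLeast0LessThan lessThan_Suc_atMost simp del: upt_Suc)

lemma measurable_history: "history n \<in> measurable P (count_space UNIV)"
proof -
  have "history n \<in> measurable P (count_space (lists (carrier H)))"
  proof (induction n)
    case 0
    show ?case
      unfolding history_0[abs_def] by (rule measurable_compose[OF measurable_coordinate]) simp
  next
    case (Suc n)
    show ?case unfolding history_Suc[abs_def]
    proof (rule measurable_compose_countable'[OF _ Suc countable_lists[OF countable_carrier]])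
      fix l assume "l \<in> lists (carrier H)"
      then show "(\<lambda>\<tau>. \<tau> (Suc n) # l) \<in> measurable P (count_space (lists (carrier H)))"
        by (intro measurable_compose[OF measurable_coordinate]) simp
    qed
  qed
  from measurable_compose[OF this, of "\<lambda>l. l" "count_space UNIV"] show ?thesis by simp
qed

primrec history_pmf :: "nat \<Rightarrow> 'a list pmf" where
  "history_pmf 0 = return_pmf [\<one>]"
| "history_pmf (Suc n) = bind_pmf (history_pmf n) (\<lambda>l. map_pmf (\<lambda>g. (hd l \<otimes> g) # l) \<mu>)"

lemma history_pmf_closed: "l \<in> set_pmf (history_pmf n) \<Longrightarrow> l \<noteq> [] \<and> l \<in> lists (carrier H)"
proof (induction n arbitrary: l)
  case (Suc n)
  then obtain l' g where l': "l' \<in> set_pmf (history_pmf n)" "g \<in> set_pmf \<mu>" "l = (hd l' \<otimes> g) # l'"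
    by auto
  then show ?case using Suc.IH[OF l'(1)] by (cases l') auto
qed simp

lemma pmf_history_pmf:
  assumes g: "range g \<subseteq> carrier H"
  shows "pmf (history_pmf n) (history n g) =
    (if g 0 = \<one> then \<Prod>i<n. pmf \<mu> (inv (g i) \<otimes> g (Suc i)) else 0)"
proof (induction n)
  case 0
  then show ?case by (auto simp: history_0 indicator_def)
next
  case (Suc n)
  have gc: "g i \<in> carrier H" for i using g by auto
  have "pmf (map_pmf (\<lambda>x. (hd l \<otimes> x) # l) \<mu>) (g (Suc n) # history n g) =
      indicator {history n g} l * pmf \<mu> (inv (g n) \<otimes> g (Suc n))" for l
  proof (cases "l = history n g")
    case True
    have "(hd l \<otimes> x = g (Suc n)) = (x = inv (g n) \<otimes> g (Suc n))" if "x \<in> set_pmf \<mu>" for x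
      using inv_solve_left[of x "g n" "g (Suc n)"] that gc True by (auto simp: hd_history)
    then have "measure (measure_pmf \<mu>) ((\<lambda>x. (hd l \<otimes> x) # l) -` {g (Suc n) # history n g}) =
        measure (measure_pmf \<mu>) {inv (g n) \<otimes> g (Suc n)}"
      using True by (intro measure_pmf.finite_measure_eq_AE) (auto simp: AE_measure_pmf_iff)
    then show ?thesis using True by (simp add: pmf_map measure_pmf_single)
  next
    case False
    then have "(\<lambda>x. (hd l \<otimes> x) # l) -` {g (Suc n) # history n g} = {}" by auto
    then show ?thesis using False by (simp add: pmf_map)
  qed
  then have "pmf (history_pmf (Suc n)) (history (Suc n) g) =
      pmf (history_pmf n) (history n g) * pmf \<mu> (inv (g n) \<otimes> g (Suc n))"
    by (simp add: history_Suc pmf_bind measure_pmf_single)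
  then show ?case using Suc by simp
qed

text \<open>On the countable set of lists of length \<open>Suc n\<close> a measure is determined by
  its atoms, and these are the cylinders prescribed by \<open>walk_measure\<close>. Expectations
  over finite times can then be computed by the recursion of \<open>history_pmf\<close>.\<close>

lemma distr_history: "distr P (count_space UNIV) (history n) = measure_pmf (history_pmf n)"
proof (rule measure_eqI_countable_AE)
  let ?L = "{l \<in> lists (carrier H). length l = Suc n}"
  show "countable ?L"
    by (rule countable_subset[OF _ countable_lists[OF countable_carrier]]) auto
  show "AE l in distr P (count_space UNIV) (history n). l \<in> ?L"
    by (subst AE_distr_iff[OF measurable_history])
       (auto simp: history_def in_lists_conv_set simp del: upt_Suc)
  have "length l = Suc n" if "l \<in> set_pmf (history_pmf n)" for l
    using that by (induction n arbitrary: l) auto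
  then show "AE l in measure_pmf (history_pmf n). l \<in> ?L"
    using history_pmf_closed by (auto simp: AE_measure_pmf_iff)
  fix l assume l: "l \<in> ?L"
  \<comment> \<open>The cylinder ignores times after \<open>n\<close>; the default
    \<open>\<one>\<close> keeps the range inside the group.\<close>
  define g where "g i = (if i \<le> n then rev l ! i else \<one>)" for i
  have g: "range g \<subseteq> carrier H"
    using l nth_mem[of _ "rev l"] by (auto simp: g_def in_lists_conv_set)
  have "map g [0..<Suc n] = rev l"
    using l by (intro nth_equalityI) (auto simp: g_def simp del: upt_Suc)
  then have lg: "l = history n g" by (simp add: history_def del: upt_Suc)
  have "history n -` {l} \<inter> space P = {\<tau> \<in> space P. \<forall>i\<le>n. \<tau> i = g i}"
    unfolding lg by (auto simp: history_def simp del: upt_Suc)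
  then have "emeasure (distr P (count_space UNIV) (history n)) {l} =
      emeasure P {\<tau> \<in> space P. \<forall>i\<le>n. \<tau> i = g i}"
    by (simp add: emeasure_distr[OF measurable_history])
  also have "\<dots> = ennreal (pmf (history_pmf n) l)"
    using walk_measure g by (simp add: emeasure_eq_measure walk_measure_def lg pmf_history_pmf)
  finally show "emeasure (distr P (count_space UNIV) (history n)) {l} = emeasure (measure_pmf (history_pmf n)) {l}"
    by (simp add: emeasure_pmf_single)
qed auto

lemma nn_integral_history:
  "(\<integral>\<^sup>+\<tau>. \<Psi> (history n \<tau>) \<partial>P) = (\<integral>\<^sup>+l. \<Psi> l \<partial>measure_pmf (history_pmf n))"
  by (simp add: nn_integral_distr[OF measurable_history] flip: distr_history)

text \<open>The Markov property in integrated form, read off from the last \<open>bind_pmf\<close>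
  of \<open>history_pmf\<close>.\<close>

lemma nn_integral_step:
  "(\<integral>\<^sup>+\<tau>. \<phi> (\<tau> n) (\<tau> (Suc n)) \<partial>P) = (\<integral>\<^sup>+\<tau>. \<integral>\<^sup>+g. \<phi> (\<tau> n) (\<tau> n \<otimes> g) \<partial>measure_pmf \<mu> \<partial>P)"
proof -
  have "(\<integral>\<^sup>+\<tau>. \<phi> (\<tau> n) (\<tau> (Suc n)) \<partial>P) = (\<integral>\<^sup>+\<tau>. \<phi> (hd (tl (history (Suc n) \<tau>))) (hd (history (Suc n) \<tau>)) \<partial>P)"
    by (simp add: history_Suc hd_history)
  also have "\<dots> = (\<integral>\<^sup>+l. \<integral>\<^sup>+g. \<phi> (hd l) (hd l \<otimes> g) \<partial>measure_pmf \<mu> \<partial>measure_pmf (history_pmf n))"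
    by (subst nn_integral_history) simp
  also have "\<dots> = (\<integral>\<^sup>+\<tau>. \<integral>\<^sup>+g. \<phi> (hd (history n \<tau>)) (hd (history n \<tau>) \<otimes> g) \<partial>measure_pmf \<mu> \<partial>P)"
    by (rule nn_integral_history[symmetric])
  finally show ?thesis by (simp add: hd_history)
qed



section \<open>Expected sums along the path\<close>

text \<open>The Green operator evaluated at the identity. Applied to the square of a function, a
  finite value forces decay of that function along almost every path.\<close>

definition green :: "('a \<Rightarrow> ennreal) \<Rightarrow> ennreal" where
  "green \<phi> = (\<Sum>i. \<integral>\<^sup>+\<tau>. \<phi> (\<tau> i) \<partial>P)"

text \<open>Whatever the position, the step \<open>s\<close> is taken with probability
  \<open>pmf \<mu> s\<close>, so fixing the step costs at most this factor.\<close>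

lemma green_step_le:
  assumes s: "s \<in> set_pmf \<mu>"
  shows "pmf \<mu> s * green (\<lambda>h. \<phi> h (h \<otimes> s)) \<le> (\<Sum>i. \<integral>\<^sup>+\<tau>. \<phi> (\<tau> i) (\<tau> (Suc i)) \<partial>P)"
proof -
  have "pmf \<mu> s * (\<integral>\<^sup>+\<tau>. \<phi> (\<tau> i) (\<tau> i \<otimes> s) \<partial>P) \<le> (\<integral>\<^sup>+\<tau>. \<phi> (\<tau> i) (\<tau> (Suc i)) \<partial>P)" for i
  proof -
    have "pmf \<mu> s * (\<integral>\<^sup>+\<tau>. \<phi> (\<tau> i) (\<tau> i \<otimes> s) \<partial>P) = (\<integral>\<^sup>+\<tau>. pmf \<mu> s * \<phi> (\<tau> i) (\<tau> i \<otimes> s) \<partial>P)"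
      by (rule nn_integral_cmult[symmetric]) (rule measurable_at)
    also have "\<dots> \<le> (\<integral>\<^sup>+\<tau>. \<integral>\<^sup>+g. \<phi> (\<tau> i) (\<tau> i \<otimes> g) \<partial>measure_pmf \<mu> \<partial>P)"
    proof (rule nn_integral_mono)
      fix \<tau>
      have "pmf \<mu> s * \<phi> (\<tau> i) (\<tau> i \<otimes> s) = (\<integral>\<^sup>+g. \<phi> (\<tau> i) (\<tau> i \<otimes> s) * indicator {s} g \<partial>measure_pmf \<mu>)"
        by (subst nn_integral_cmult_indicator) (simp_all add: emeasure_pmf_single mult.commute)
      also have "\<dots> \<le> (\<integral>\<^sup>+g. \<phi> (\<tau> i) (\<tau> i \<otimes> g) \<partial>measure_pmf \<mu>)"
        by (rule nn_integral_mono) (auto simp: indicator_def)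
      finally show "pmf \<mu> s * \<phi> (\<tau> i) (\<tau> i \<otimes> s) \<le> (\<integral>\<^sup>+g. \<phi> (\<tau> i) (\<tau> i \<otimes> g) \<partial>measure_pmf \<mu>)" .
    qed
    finally show ?thesis by (simp add: nn_integral_step)
  qed
  then show ?thesis
    unfolding green_def ennreal_suminf_cmult[symmetric] by (intro suminf_le summableI)
qed

lemma green_step_finite:
  assumes s: "s \<in> set_pmf \<mu>" and fin: "(\<Sum>i. \<integral>\<^sup>+\<tau>. \<phi> (\<tau> i) (\<tau> (Suc i)) \<partial>P) < \<infinity>"
  shows "green (\<lambda>h. \<phi> h (h \<otimes> s)) < \<infinity>"
proof (rule ccontr)
  assume "\<not> ?thesis"
  then have "green (\<lambda>h. \<phi> h (h \<otimes> s)) = \<infinity>" by (simp add: not_less top_unique)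
  then show False
    using green_step_le[OF s, of \<phi>] fin s pmf_positive[OF s]
    by (auto simp: ennreal_mult_top top_unique)
qed

lemma green_cong: "(\<And>h. h \<in> carrier H \<Longrightarrow> \<phi> h = \<psi> h) \<Longrightarrow> green \<phi> = green \<psi>"
  unfolding green_def by (intro suminf_cong nn_integral_cong) auto

lemma green_mono: "(\<And>h. h \<in> carrier H \<Longrightarrow> \<phi> h \<le> \<psi> h) \<Longrightarrow> green \<phi> \<le> green \<psi>"
  unfolding green_def by (intro suminf_le nn_integral_mono) auto

lemma green_add: "green (\<lambda>h. \<phi> h + \<psi> h) = green \<phi> + green \<psi>"
  unfolding green_def by (subst nn_integral_add) (auto intro!: suminf_add[symmetric] measurable_at)

lemma green_cmult: "green (\<lambda>h. c * \<phi> h) = c * green \<phi>"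
  unfolding green_def by (subst nn_integral_cmult) (auto intro!: measurable_at)

text \<open>For a single step, time is shifted by one, which only drops a term of the sum. Products
  follow because the induction covers all \<open>\<phi>\<close> at once.\<close>

lemma green_translate:
  assumes "g \<in> carrier H" "green \<phi> < \<infinity>"
  shows "green (\<lambda>h. \<phi> (h \<otimes> g)) < \<infinity>"
proof -
  have "g \<in> semigroup_span H (set_pmf \<mu>)" using assms span_step by simp
  then show ?thesis using assms(2)
  proof (induction arbitrary: \<phi>)
    case (incl s)
    have "(\<Sum>i. \<integral>\<^sup>+\<tau>. \<phi> (\<tau> (Suc i)) \<partial>P) \<le> green \<phi>"
      unfolding green_def
    proof (rule suminf_le_const[OF summableI])
      fix n
      have "(\<Sum>i<n. \<integral>\<^sup>+\<tau>. \<phi> (\<tau> (Suc i)) \<partial>P) \<le> (\<Sum>i<Suc n. \<integral>\<^sup>+\<tau>. \<phi> (\<tau> i) \<partial>P)"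
        unfolding sum.lessThan_Suc_shift by simp
      also have "\<dots> \<le> (\<Sum>i. \<integral>\<^sup>+\<tau>. \<phi> (\<tau> i) \<partial>P)" by (rule sum_le_suminf) auto
      finally show "(\<Sum>i<n. \<integral>\<^sup>+\<tau>. \<phi> (\<tau> (Suc i)) \<partial>P) \<le> (\<Sum>i. \<integral>\<^sup>+\<tau>. \<phi> (\<tau> i) \<partial>P)" .
    qed
    then have "(\<Sum>i. \<integral>\<^sup>+\<tau>. \<phi> (\<tau> (Suc i)) \<partial>P) < \<infinity>" using incl(2) by (rule le_less_trans)
    then show ?case using green_step_finite[OF incl(1), of "\<lambda>_. \<phi>"] by simp
  next
    case (mult g g')
    then have gc: "g \<in> carrier H" "g' \<in> carrier H" by (simp_all add: span_step)
    have "green (\<lambda>h. \<phi> (h \<otimes> (g \<otimes> g'))) = green (\<lambda>h. \<phi> (h \<otimes> g \<otimes> g'))"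
      by (rule green_cong) (use gc in \<open>simp add: m_assoc\<close>)
    moreover have "green (\<lambda>h. \<phi> (h \<otimes> g \<otimes> g')) < \<infinity>"
      by (rule mult.IH(1)[of "\<lambda>h. \<phi> (h \<otimes> g')"]) (use mult in auto)
    ultimately show ?case by simp
  qed
qed

text \<open>The sum of the squares has finite expectation, so it is finite almost surely and its
  terms vanish.\<close>

lemma AE_tendsto_0:
  fixes x :: "(nat \<Rightarrow> 'a) \<Rightarrow> nat \<Rightarrow> real"
  assumes meas: "\<And>i. (\<lambda>\<tau>. x \<tau> i) \<in> borel_measurable P"
    and fin: "(\<Sum>i. \<integral>\<^sup>+\<tau>. ennreal ((x \<tau> i)\<^sup>2) \<partial>P) < \<infinity>"
  shows "AE \<tau> in P. x \<tau> \<longlonglongrightarrow> 0"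
proof -
  note [measurable] = meas
  have "(\<integral>\<^sup>+\<tau>. (\<Sum>i. ennreal ((x \<tau> i)\<^sup>2)) \<partial>P) = (\<Sum>i. \<integral>\<^sup>+\<tau>. ennreal ((x \<tau> i)\<^sup>2) \<partial>P)"
    by (rule nn_integral_suminf) measurable
  then have "AE \<tau> in P. (\<Sum>i. ennreal ((x \<tau> i)\<^sup>2)) \<noteq> \<infinity>"
    by (intro nn_integral_PInf_AE) (use fin in auto)
  then show ?thesis
  proof eventually_elim
    case (elim \<tau>)
    then have "summable (\<lambda>i. (x \<tau> i)\<^sup>2)" by (intro summable_suminf_not_top) auto
    then have "(\<lambda>i. (x \<tau> i)\<^sup>2) \<longlonglongrightarrow> 0" by (rule summable_LIMSEQ_zero)
    then show ?case by simp
  qed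
qed

section \<open>Bounded harmonic functions along the path\<close>

context
  fixes f :: "'a \<Rightarrow> real"
  assumes harm: "harmonic f" and bounds: "\<And>h. h \<in> carrier H \<Longrightarrow> 0 \<le> f h \<and> f h \<le> 1"
begin

text \<open>Pythagoras: harmonicity makes the increment \<open>f (h \<otimes> g) - f h\<close>
  centred, hence orthogonal to the constant \<open>f h\<close>.\<close>

lemma energy_step:
  assumes h: "h \<in> carrier H"
  shows "(\<integral>\<^sup>+g. ennreal ((f (h \<otimes> g))\<^sup>2) \<partial>measure_pmf \<mu>) =
    ennreal ((f h)\<^sup>2) + (\<integral>\<^sup>+g. ennreal ((f (h \<otimes> g) - f h)\<^sup>2) \<partial>measure_pmf \<mu>)"
proof -
  have b: "\<bar>f g\<bar> \<le> 1" "(f g)\<^sup>2 \<le> 1" "\<bar>f g - f h\<bar> \<le> 1" "(f g - f h)\<^sup>2 \<le> 1" if "g \<in> carrier H" for g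
    using bounds[OF that] bounds[OF h] by (auto simp: abs_square_le_1 power_le_one)
  have i1: "integrable (measure_pmf \<mu>) (\<lambda>g. f (h \<otimes> g))"
    by (rule integrable_bounded_step[of _ 1]) (use b h in auto)
  have i2: "integrable (measure_pmf \<mu>) (\<lambda>g. (f (h \<otimes> g))\<^sup>2)"
    by (rule integrable_bounded[of _ 1]) (use b h in auto)
  have i3: "integrable (measure_pmf \<mu>) (\<lambda>g. (f (h \<otimes> g) - f h)\<^sup>2)"
    by (rule integrable_bounded[of _ 1]) (use b h in auto)
  have "(\<integral>g. (f (h \<otimes> g) - f h)\<^sup>2 \<partial>measure_pmf \<mu>) =
      (\<integral>g. (f (h \<otimes> g))\<^sup>2 - 2 * f h * f (h \<otimes> g) + (f h)\<^sup>2 \<partial>measure_pmf \<mu>)"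
    by (simp add: power2_diff algebra_simps)
  also have "\<dots> = (\<integral>g. (f (h \<otimes> g))\<^sup>2 \<partial>measure_pmf \<mu>) - 2 * f h * f h + (f h)\<^sup>2"
    using i1 i2 harm h by (simp add: harmonic_def)
  finally have "(\<integral>g. (f (h \<otimes> g))\<^sup>2 \<partial>measure_pmf \<mu>) = (f h)\<^sup>2 + (\<integral>g. (f (h \<otimes> g) - f h)\<^sup>2 \<partial>measure_pmf \<mu>)"
    by (simp add: power2_eq_square)
  then show ?thesis
    using i2 i3 by (simp add: nn_integral_eq_integral integral_nonneg_AE flip: ennreal_plus)
qed

text \<open>The step identity telescopes along the walk. As \<open>f\<close> is bounded by one, so
  is the total energy of the increments, uniformly in \<open>n\<close>.\<close>

lemma energy_sum:
  "(\<Sum>i<n. \<integral>\<^sup>+\<tau>. ennreal ((f (\<tau> (Suc i)) - f (\<tau> i))\<^sup>2) \<partial>P) \<le> (\<integral>\<^sup>+\<tau>. ennreal ((f (\<tau> n))\<^sup>2) \<partial>P)"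
proof (induction n)
  case (Suc n)
  have "(\<integral>\<^sup>+\<tau>. ennreal ((f (\<tau> (Suc n)))\<^sup>2) \<partial>P) =
      (\<integral>\<^sup>+\<tau>. \<integral>\<^sup>+g. ennreal ((f (\<tau> n \<otimes> g))\<^sup>2) \<partial>measure_pmf \<mu> \<partial>P)"
    using nn_integral_step[of "\<lambda>_ h. ennreal ((f h)\<^sup>2)" n] by simp
  also have "\<dots> = (\<integral>\<^sup>+\<tau>. ennreal ((f (\<tau> n))\<^sup>2) + (\<integral>\<^sup>+g. ennreal ((f (\<tau> n \<otimes> g) - f (\<tau> n))\<^sup>2) \<partial>measure_pmf \<mu>) \<partial>P)"
    by (intro nn_integral_cong energy_step) simp
  also have "\<dots> = (\<integral>\<^sup>+\<tau>. ennreal ((f (\<tau> n))\<^sup>2) \<partial>P) +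
      (\<integral>\<^sup>+\<tau>. \<integral>\<^sup>+g. ennreal ((f (\<tau> n \<otimes> g) - f (\<tau> n))\<^sup>2) \<partial>measure_pmf \<mu> \<partial>P)"
    by (rule nn_integral_add) (rule measurable_at)+
  also have "(\<integral>\<^sup>+\<tau>. \<integral>\<^sup>+g. ennreal ((f (\<tau> n \<otimes> g) - f (\<tau> n))\<^sup>2) \<partial>measure_pmf \<mu> \<partial>P) =
      (\<integral>\<^sup>+\<tau>. ennreal ((f (\<tau> (Suc n)) - f (\<tau> n))\<^sup>2) \<partial>P)"
    by (rule nn_integral_step[of "\<lambda>h h'. ennreal ((f h' - f h)\<^sup>2)", symmetric])
  finally show ?case using Suc by (simp add: add_right_mono)
qed simp

lemma energy_finite: "(\<Sum>i. \<integral>\<^sup>+\<tau>. ennreal ((f (\<tau> (Suc i)) - f (\<tau> i))\<^sup>2) \<partial>P) < \<infinity>"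
proof -
  have "(\<Sum>i. \<integral>\<^sup>+\<tau>. ennreal ((f (\<tau> (Suc i)) - f (\<tau> i))\<^sup>2) \<partial>P) \<le> 1"
  proof (rule suminf_le_const[OF summableI])
    fix n
    have "(\<integral>\<^sup>+\<tau>. ennreal ((f (\<tau> n))\<^sup>2) \<partial>P) \<le> (\<integral>\<^sup>+\<tau>. 1 \<partial>P)"
      by (rule nn_integral_mono) (use bounds in \<open>auto simp: power_le_one\<close>)
    then show "(\<Sum>i<n. \<integral>\<^sup>+\<tau>. ennreal ((f (\<tau> (Suc i)) - f (\<tau> i))\<^sup>2) \<partial>P) \<le> 1"
      using energy_sum[of n] by (simp add: emeasure_space_1)
  qed
  then show ?thesis using le_less_trans by fastforce
qed

lemma AE_increment_tendsto_0: "AE \<tau> in P. (\<lambda>i. f (\<tau> (Suc i)) - f (\<tau> i)) \<longlonglongrightarrow> 0"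
  by (rule AE_tendsto_0[OF _ energy_finite]) (rule measurable_at2)

text \<open>A single step inherits the energy bound. For a product, the difference is split at
  \<open>h \<otimes> g\<close>, and \<open>green_translate\<close> moves the base point of the outer
  part from \<open>h\<close> to \<open>h \<otimes> g\<close>.\<close>

lemma green_translation_energy:
  assumes "g \<in> carrier H"
  shows "green (\<lambda>h. ennreal ((f (h \<otimes> g) - f h)\<^sup>2)) < \<infinity>"
proof -
  have "g \<in> semigroup_span H (set_pmf \<mu>)" using assms span_step by simp
  then show ?thesis
  proof induction
    case (incl s)
    then show ?case
      by (rule green_step_finite[of s "\<lambda>h h'. ennreal ((f h' - f h)\<^sup>2)"]) (rule energy_finite)
  next
    case (mult g g')
    then have gc: "g \<in> carrier H" "g' \<in> carrier H" by (simp_all add: span_step)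
    have "green (\<lambda>h. ennreal ((f (h \<otimes> (g \<otimes> g')) - f h)\<^sup>2)) \<le>
        green (\<lambda>h. 2 * ennreal ((f (h \<otimes> g \<otimes> g') - f (h \<otimes> g))\<^sup>2) + 2 * ennreal ((f (h \<otimes> g) - f h)\<^sup>2))"
    proof (rule green_mono)
      fix h assume h: "h \<in> carrier H"
      have "(a - c)\<^sup>2 \<le> 2 * (a - b)\<^sup>2 + 2 * (b - c)\<^sup>2" for a b c :: real
        using zero_le_power2[of "(a - b) - (b - c)"] by (simp add: power2_eq_square algebra_simps)
      then have "ennreal ((f (h \<otimes> g \<otimes> g') - f h)\<^sup>2) \<le>
          ennreal (2 * (f (h \<otimes> g \<otimes> g') - f (h \<otimes> g))\<^sup>2 + 2 * (f (h \<otimes> g) - f h)\<^sup>2)"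
        by (rule ennreal_leI)
      then show "ennreal ((f (h \<otimes> (g \<otimes> g')) - f h)\<^sup>2) \<le>
          2 * ennreal ((f (h \<otimes> g \<otimes> g') - f (h \<otimes> g))\<^sup>2) + 2 * ennreal ((f (h \<otimes> g) - f h)\<^sup>2)"
        using h gc by (simp add: m_assoc ennreal_plus ennreal_mult)
    qed
    also have "\<dots> = 2 * green (\<lambda>h. ennreal ((f (h \<otimes> g \<otimes> g') - f (h \<otimes> g))\<^sup>2)) +
        2 * green (\<lambda>h. ennreal ((f (h \<otimes> g) - f h)\<^sup>2))"
      by (simp only: green_add green_cmult)
    also have "\<dots> < \<infinity>"
      using mult.IH green_translate[OF gc(1) mult.IH(2)] by (simp add: ennreal_mult_less_top)
    finally show ?case .
  qed
qed

lemma AE_translate_tendsto_0: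
  assumes "g \<in> carrier H"
  shows "AE \<tau> in P. (\<lambda>i. f (\<tau> i \<otimes> g) - f (\<tau> i)) \<longlonglongrightarrow> 0"
  by (rule AE_tendsto_0[OF _ green_translation_energy[OF assms, unfolded green_def]])
     (rule measurable_at)

text \<open>Ville's inequality. \<open>Z\<close> is frozen at one as soon as level \<open>c\<close>
  is reached and equals \<open>f / c\<close> before, so its expectation never increases, starts at
  most at \<open>f \<one> / c\<close> and dominates the probability of having reached
  \<open>c\<close>.\<close>

lemma maximal_inequality:
  assumes c: "0 < c"
  shows "emeasure P {\<tau> \<in> space P. \<exists>i. c \<le> f (\<tau> i)} \<le> ennreal (f \<one> / c)"
proof -
  define Z where "Z l = (if \<exists>x\<in>set l. c \<le> f x then 1 else ennreal (f (hd l) / c))" for l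
  have Z_step: "(\<integral>\<^sup>+g. Z ((hd l \<otimes> g) # l) \<partial>measure_pmf \<mu>) \<le> Z l"
    if l: "l \<noteq> [] \<and> l \<in> lists (carrier H)" for l
  proof (cases "\<exists>x\<in>set l. c \<le> f x")
    case True
    then show ?thesis by (simp add: Z_def)
  next
    case False
    have hdl: "hd l \<in> carrier H" using l by (cases l) auto
    have "(\<integral>\<^sup>+g. Z ((hd l \<otimes> g) # l) \<partial>measure_pmf \<mu>) \<le> (\<integral>\<^sup>+g. ennreal (f (hd l \<otimes> g) / c) \<partial>measure_pmf \<mu>)"
      by (rule nn_integral_mono) (use False c in \<open>auto simp: Z_def simp flip: ennreal_1\<close>)
    also have "\<dots> = ennreal (\<integral>g. f (hd l \<otimes> g) / c \<partial>measure_pmf \<mu>)"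
    proof (rule nn_integral_eq_integral)
      show "integrable (measure_pmf \<mu>) (\<lambda>g. f (hd l \<otimes> g) / c)"
        using integrable_bounded_step[of f 1, OF _ hdl] bounds by simp
      show "AE g in measure_pmf \<mu>. 0 \<le> f (hd l \<otimes> g) / c"
        using bounds hdl c by (auto simp: AE_measure_pmf_iff)
    qed
    also have "\<dots> = ennreal (f (hd l) / c)" using harm hdl by (simp add: harmonic_def)
    finally show ?thesis using False by (simp add: Z_def)
  qed
  have Z_le: "(\<integral>\<^sup>+l. Z l \<partial>measure_pmf (history_pmf n)) \<le> ennreal (f \<one> / c)" for n
  proof (induction n)
    case 0
    show ?case using c by (auto simp: Z_def simp flip: ennreal_1)
  next
    case (Suc n)
    have "(\<integral>\<^sup>+l. Z l \<partial>measure_pmf (history_pmf (Suc n))) =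
        (\<integral>\<^sup>+l. \<integral>\<^sup>+g. Z ((hd l \<otimes> g) # l) \<partial>measure_pmf \<mu> \<partial>measure_pmf (history_pmf n))" by simp
    also have "\<dots> \<le> (\<integral>\<^sup>+l. Z l \<partial>measure_pmf (history_pmf n))"
      by (rule nn_integral_mono_AE) (use Z_step history_pmf_closed in \<open>auto simp: AE_measure_pmf_iff\<close>)
    finally show ?case using Suc by (rule order_trans)
  qed
  define S where "S n = {\<tau> \<in> space P. \<exists>i\<le>n. c \<le> f (\<tau> i)}" for n
  have S_sets: "S n \<in> sets P" for n
    unfolding S_def by measurable
  have "emeasure P (S n) \<le> ennreal (f \<one> / c)" for n
  proof -
    have "emeasure P (S n) = (\<integral>\<^sup>+\<tau>. indicator (S n) \<tau> \<partial>P)" using S_sets by simp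
    also have "\<dots> \<le> (\<integral>\<^sup>+\<tau>. Z (history n \<tau>) \<partial>P)"
      by (rule nn_integral_mono) (auto simp: S_def Z_def set_history indicator_def)
    also have "\<dots> \<le> ennreal (f \<one> / c)" unfolding nn_integral_history by (rule Z_le)
    finally show ?thesis .
  qed
  moreover have "(\<lambda>n. emeasure P (S n)) \<longlonglongrightarrow> emeasure P (\<Union>n. S n)"
    by (rule Lim_emeasure_incseq) (use S_sets in \<open>auto simp: S_def incseq_def intro: order_trans\<close>)
  ultimately have "emeasure P (\<Union>n. S n) \<le> ennreal (f \<one> / c)"
    by (intro LIMSEQ_le_const2[where a = "ennreal (f \<one> / c)"]) auto
  moreover have "(\<Union>n. S n) = {\<tau> \<in> space P. \<exists>i. c \<le> f (\<tau> i)}" by (auto simp: S_def)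
  ultimately show ?thesis by simp
qed

end

text \<open>\<open>f k\<close> ever reaches \<open>c\<close> with probability at most
  \<open>f k \<one> / c\<close>. The exceptional event is contained in all these events, whose
  probabilities tend to zero.\<close>

lemma AE_stays_small:
  fixes f :: "nat \<Rightarrow> 'a \<Rightarrow> real"
  assumes harm: "\<And>k. harmonic (f k)" and bounds: "\<And>k h. h \<in> carrier H \<Longrightarrow> 0 \<le> f k h \<and> f k h \<le> 1"
    and lim: "(\<lambda>k. f k \<one>) \<longlonglongrightarrow> 0" and c: "0 < c"
  shows "AE \<tau> in P. \<exists>k. \<forall>i. f k (\<tau> i) < c"
proof -
  define N where "N = {\<tau> \<in> space P. \<forall>k. \<exists>i. c \<le> f k (\<tau> i)}"
  have N: "N \<in> sets P" unfolding N_def by measurable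
  have "emeasure P N \<le> ennreal (f k \<one> / c)" for k
    by (rule order_trans[OF emeasure_mono maximal_inequality[OF harm bounds c]]) (auto simp: N_def)
  moreover have "(\<lambda>k. ennreal (f k \<one> / c)) \<longlonglongrightarrow> ennreal (0 / c)"
    by (intro tendsto_ennrealI tendsto_divide lim tendsto_const) (use c in auto)
  ultimately have "emeasure P N \<le> 0"
    by (intro LIMSEQ_le_const[where X = "\<lambda>k. ennreal (f k \<one> / c)"]) auto
  then have "emeasure P N = 0" by simp
  then have "AE \<tau> in P. \<tau> \<notin> N" using N by (intro AE_not_in) (simp add: null_sets_def)
  then show ?thesis by (rule AE_mp) (auto simp: N_def not_le)
qed

end

section \<open>Convergence to the boundary\<close>

locale semidirect_walk = free_subgroup H F X + random_walk H \<mu> P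
  for H :: "('a, 'b) monoid_scheme" (structure) and F X \<mu> P +
  fixes A :: "'a set" and u :: 'a
  assumes semidirect: "inner_semidirect H F A"
    and card_X: "2 \<le> card X"
    and u_F: "u \<in> F" and u_neq_one: "u \<noteq> \<one>"
    and u_fixed: "\<And>a. a \<in> A \<Longrightarrow> a \<otimes> u \<otimes> inv a = u"
begin

lemma A_subgroup: "subgroup A H" and A_F: "F \<inter> A = {\<one>}"
  using semidirect by (simp_all add: inner_semidirect_def)

lemma A_closed [simp]: "a \<in> A \<Longrightarrow> a \<in> carrier H"
  using A_subgroup subgroup.subset by fast

lemma conjugate_F: "h \<in> carrier H \<Longrightarrow> x \<in> F \<Longrightarrow> h \<otimes> x \<otimes> inv h \<in> F"
  using semidirect by (auto simp: inner_semidirect_def normal.inv_op_closed2)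

section \<open>The coordinate in \<open>F\<close> and the conjugates of \<open>u\<close>\<close>

text \<open>Forgetting the factor in \<open>A\<close> is compatible with left multiplication by
  \<open>F\<close>, so the tree geometry of \<open>F\<close> applies to subsets of
  \<open>H\<close>.\<close>

definition proj :: "'a \<Rightarrow> 'a" where
  "proj g = (THE x. x \<in> F \<and> (\<exists>a\<in>A. g = x \<otimes> a))"

lemma proj_eqI:
  assumes "x \<in> F" "a \<in> A" shows "proj (x \<otimes> a) = x"
  unfolding proj_def
proof (rule the_equality)
  fix y assume "y \<in> F \<and> (\<exists>b\<in>A. x \<otimes> a = y \<otimes> b)"
  then obtain b where y: "y \<in> F" and b: "b \<in> A" "x \<otimes> a = y \<otimes> b" by blast
  have "inv y \<otimes> x = inv y \<otimes> (x \<otimes> a) \<otimes> inv a" using y assms by (simp add: m_assoc)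
  also have "\<dots> = b \<otimes> inv a" unfolding b(2) using y b assms by (simp add: inv_mult_cancel)
  finally have eq: "inv y \<otimes> x = b \<otimes> inv a" .
  have "b \<otimes> inv a \<in> A" using A_subgroup b assms
    by (simp add: subgroup.m_closed subgroup.m_inv_closed)
  then have "inv y \<otimes> x = \<one>" using A_F y assms eq F_mult[of "inv y" x] by auto
  then have "y \<otimes> (inv y \<otimes> x) = y" using y by simp
  then show "y = x" using y assms by (simp add: inv_mult_cancel)
qed (use assms in blast)

lemma proj_decomp:
  assumes "g \<in> carrier H"
  obtains a where "proj g \<in> F" "a \<in> A" "g = proj g \<otimes> a"
proof -
  have "g \<in> F <#> A" using semidirect assms by (simp add: inner_semidirect_def)
  then obtain x a where "x \<in> F" "a \<in> A" "g = x \<otimes> a" by (auto simp: set_mult_def)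
  then show thesis using that proj_eqI by metis
qed

lemma proj_F [simp]: "g \<in> carrier H \<Longrightarrow> proj g \<in> F"
  using proj_decomp by blast

lemma proj_mult: "x \<in> F \<Longrightarrow> g \<in> carrier H \<Longrightarrow> proj (x \<otimes> g) = x \<otimes> proj g"
proof -
  assume x: "x \<in> F" and "g \<in> carrier H"
  then obtain a where a: "proj g \<in> F" "a \<in> A" "g = proj g \<otimes> a" using proj_decomp by blast
  then have "x \<otimes> g = (x \<otimes> proj g) \<otimes> a" using x by (metis F_closed A_closed m_assoc)
  then show ?thesis using proj_eqI[of "x \<otimes> proj g" a] a x by simp
qed

definition conj_u :: "'a \<Rightarrow> 'a" where "conj_u g = g \<otimes> u \<otimes> inv g"

lemma conj_u_F [simp]: "g \<in> carrier H \<Longrightarrow> conj_u g \<in> F"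
  by (simp add: conj_u_def conjugate_F u_F)

lemma u_closed [simp]: "u \<in> carrier H"
  using u_F by simp

text \<open>The factor in \<open>A\<close> commutes with \<open>u\<close>: this is where the
  invariance of \<open>u\<close> enters.\<close>

lemma conj_u_proj:
  assumes "g \<in> carrier H" shows "conj_u g = proj g \<otimes> u \<otimes> inv (proj g)"
proof -
  obtain a where a: "proj g \<in> F" "a \<in> A" "g = proj g \<otimes> a" using proj_decomp[OF assms] .
  have "conj_u g = proj g \<otimes> (a \<otimes> u \<otimes> inv a) \<otimes> inv (proj g)"
    unfolding conj_u_def using a(1,2) by (subst (1 2) a(3)) (simp add: m_assoc inv_mult_group)
  then show ?thesis using u_fixed a by simp
qed

lemma conj_u_neq_one:
  assumes "g \<in> carrier H" shows "conj_u g \<noteq> \<one>"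
proof
  assume "conj_u g = \<one>"
  then have "inv g \<otimes> conj_u g \<otimes> g = \<one>" using assms by simp
  then show False using assms u_neq_one by (simp add: conj_u_def m_assoc inv_mult_cancel)
qed

lemma conj_u_pow: "g \<in> carrier H \<Longrightarrow> conj_u g [^] (k::nat) \<otimes> g = g \<otimes> u [^] k"
proof (induction k)
  case (Suc k)
  have "conj_u g [^] Suc k \<otimes> g = conj_u g [^] k \<otimes> (conj_u g \<otimes> g)" using Suc.prems by (simp add: m_assoc)
  also have "conj_u g \<otimes> g = g \<otimes> u" using Suc.prems by (simp add: conj_u_def m_assoc)
  also have "conj_u g [^] k \<otimes> (g \<otimes> u) = (conj_u g [^] k \<otimes> g) \<otimes> u" using Suc.prems by (simp add: m_assoc)
  also have "\<dots> = g \<otimes> u [^] Suc k" using Suc by (simp add: m_assoc)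
  finally show ?case .
qed simp

text \<open>A right translation by a fixed power of \<open>u\<close> acts on coordinates as a left
  translation by that power of \<open>conj_u h\<close>. Asymptotic invariance under right translates
  thereby becomes invariance under powers of the moving conjugates.\<close>

lemma proj_translate:
  assumes "h \<in> carrier H" "g \<in> carrier H"
  shows "proj (h \<otimes> u [^] (k::nat) \<otimes> g) = conj_u h [^] k \<otimes> proj (h \<otimes> g)"
proof -
  have "h \<otimes> u [^] k \<otimes> g = conj_u h [^] k \<otimes> (h \<otimes> g)"
    using assms by (simp add: m_assoc flip: conj_u_pow)
  then show ?thesis using assms by (simp add: proj_mult)
qed

section \<open>Test sets\<close>

definition lift :: "'a set \<Rightarrow> 'a set" where "lift C = {g \<in> carrier H. proj g \<in> C}"

text \<open>If \<open>length v < n\<close>, no word except \<open>v\<close> itself qualifies; for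
  fixed \<open>n\<close> these sets thus partition all of \<open>F\<close>, short words
  included.\<close>

definition cyl :: "nat \<Rightarrow> 'a letter list \<Rightarrow> 'a set" where
  "cyl n v = {x \<in> F. take n (rf x) = v}"

text \<open>Kept countable for the diagonal argument and for the union of null sets. Cylinders
  detect prefixes, the other sets detect concentration at the ends of an axis.\<close>

definition test_sets :: "'a set set" where
  "test_sets = (\<lambda>(n, v). lift (cyl n v)) ` (UNIV \<times> lists (X \<times> UNIV)) \<union>
     (\<lambda>(w, k). lift (near_ends w k)) ` (F \<times> UNIV)"

lemma countable_F: "countable F"
  using countable_subset[OF _ countable_carrier] by blast

lemma countable_test_sets: "countable test_sets"
  unfolding test_sets_def using finite_X countable_F
  by (intro countable_Un countable_image countable_SIGMA countable_lists) (auto intro: countable_finite)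

lemma cyl_test: "v \<in> lists (X \<times> UNIV) \<Longrightarrow> lift (cyl n v) \<in> test_sets"
  and near_ends_test: "w \<in> F \<Longrightarrow> lift (near_ends w k) \<in> test_sets"
  by (auto simp: test_sets_def)

context
  fixes f :: "'a set \<Rightarrow> 'a \<Rightarrow> real"
  assumes f_harmonic: "\<And>B. B \<in> test_sets \<Longrightarrow> harmonic (f B)"
    and f_linear: "\<And>I h B c b. finite I \<Longrightarrow> (\<And>i::nat. i \<in> I \<Longrightarrow> h i \<in> carrier H) \<Longrightarrow>
      (\<And>i. i \<in> I \<Longrightarrow> B i \<in> test_sets) \<Longrightarrow>
      (\<And>g. g \<in> carrier H \<Longrightarrow> (\<Sum>i\<in>I. c i * indicator (B i) (h i \<otimes> g)) \<le> (b::real)) \<Longrightarrow>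
      (\<Sum>i\<in>I. c i * f (B i) (h i)) \<le> b"
begin

section \<open>Mass estimates for the stationary mean\<close>

lemma f_bounds: "B \<in> test_sets \<Longrightarrow> h \<in> carrier H \<Longrightarrow> 0 \<le> f B h \<and> f B h \<le> 1"
  using f_linear[of "{0}" "\<lambda>_. h" "\<lambda>_. B" "\<lambda>_. 1" 1]
    f_linear[of "{0}" "\<lambda>_. h" "\<lambda>_. B" "\<lambda>_. -1" 0]
  by (auto simp: indicator_def)

lemma f_mono:
  assumes "B \<in> test_sets" "B' \<in> test_sets" "B \<subseteq> B'" "h \<in> carrier H"
  shows "f B h \<le> f B' h"
proof -
  have two: "(\<Sum>i\<in>{0, 1::nat}. F i) = F 0 + F 1" for F :: "nat \<Rightarrow> real" by simp
  have "(\<Sum>i\<in>{0, 1::nat}. (if i = 0 then 1 else -1) * f (if i = 0 then B else B') h) \<le> 0"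
  proof (rule f_linear[of _ "\<lambda>_. h" "\<lambda>i. if i = 0 then B else B'" "\<lambda>i. if i = 0 then 1 else -1"])
    fix g
    show "(\<Sum>i\<in>{0, 1::nat}. (if i = 0 then 1 else -1) * indicator (if i = 0 then B else B') (h \<otimes> g)) \<le> (0::real)"
      unfolding two using assms(3) by (cases "h \<otimes> g \<in> B") auto
  qed (use assms in auto)
  then show ?thesis by simp
qed

text \<open>With \<open>f B h\<close> read as the mass of \<open>inv h\<close> applied to
  \<open>B\<close>, the hypothesis says that these translates are disjoint, so their masses sum to
  at most one.\<close>

lemma f_packing:
  assumes B: "B \<in> test_sets" and h: "\<And>i::nat. i < n \<Longrightarrow> h i \<in> carrier H"
    and disj: "\<And>g i j. g \<in> carrier H \<Longrightarrow> i < j \<Longrightarrow> j < n \<Longrightarrow> h i \<otimes> g \<in> B \<Longrightarrow> h j \<otimes> g \<in> B \<Longrightarrow> False"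
  shows "(\<Sum>i<n. f B (h i)) \<le> 1"
proof -
  have "(\<Sum>i<n. 1 * f B (h i)) \<le> 1"
  proof (rule f_linear[of _ h "\<lambda>_. B" "\<lambda>_. 1"])
    fix g assume g: "g \<in> carrier H"
    have "i = j" if "i < n" "j < n" "h i \<otimes> g \<in> B" "h j \<otimes> g \<in> B" for i j
      using disj[OF g, of i j] disj[OF g, of j i] that by (metis linorder_neqE_nat)
    then have "card {i \<in> {..<n}. h i \<otimes> g \<in> B} \<le> Suc 0"
      by (subst card_le_Suc0_iff_eq) auto
    then have "real (card {i \<in> {..<n}. h i \<otimes> g \<in> B}) \<le> 1" by simp
    also have "real (card {i \<in> {..<n}. h i \<otimes> g \<in> B}) = (\<Sum>i<n. 1 * indicator B (h i \<otimes> g))"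
      by (simp add: indicator_def sum.If_cases Int_def)
    finally show "(\<Sum>i<n. 1 * indicator B (h i \<otimes> g)) \<le> (1::real)" .
  qed (use B h in auto)
  then show ?thesis by simp
qed

lemma f_covering:
  assumes V: "finite V" and B: "\<And>v. v \<in> V \<Longrightarrow> B v \<in> test_sets" and h: "h \<in> carrier H"
    and cov: "\<And>g. g \<in> carrier H \<Longrightarrow> \<exists>v\<in>V. h \<otimes> g \<in> B v"
  shows "1 \<le> (\<Sum>v\<in>V. f (B v) h)"
proof -
  \<comment> \<open>\<open>f_linear\<close> is indexed by natural numbers, so \<open>V\<close> is
    enumerated.\<close>
  obtain e where e: "bij_betw e {0..<card V} V" using ex_bij_betw_nat_finite[OF V] by blast
  have "(\<Sum>i\<in>{0..<card V}. -1 * f (B (e i)) h) \<le> -1"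
  proof (rule f_linear[of _ "\<lambda>_. h" "\<lambda>i. B (e i)" "\<lambda>_. -1"])
    fix g assume "g \<in> carrier H"
    then obtain v where "v \<in> V" "h \<otimes> g \<in> B v" using cov by blast
    moreover have "v \<in> e ` {0..<card V}" using e \<open>v \<in> V\<close> by (simp add: bij_betw_def)
    ultimately obtain i where i: "i \<in> {0..<card V}" "h \<otimes> g \<in> B (e i)" by blast
    have "1 = (indicator (B (e i)) (h \<otimes> g) :: real)" using i by simp
    also have "\<dots> \<le> (\<Sum>i\<in>{0..<card V}. indicator (B (e i)) (h \<otimes> g))"
      by (rule member_le_sum) (use i in auto)
    finally show "(\<Sum>i\<in>{0..<card V}. -1 * indicator (B (e i)) (h \<otimes> g)) \<le> (-1::real)"
      by (simp add: sum_negf)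
  qed (use e B h bij_betwE[OF e] in auto)
  moreover have "(\<Sum>i\<in>{0..<card V}. f (B (e i)) h) = (\<Sum>v\<in>V. f (B v) h)"
    by (rule sum.reindex_bij_betw[OF e])
  ultimately show ?thesis by (simp add: sum_negf)
qed

lemma f_covering2:
  assumes B: "B \<in> test_sets" and h: "h \<in> carrier H" "h' \<in> carrier H"
    and cov: "\<And>g. g \<in> carrier H \<Longrightarrow> h \<otimes> g \<in> B \<or> h' \<otimes> g \<in> B"
  shows "1 \<le> f B h + f B h'"
  using f_linear[of "{0, 1}" "\<lambda>i. if i = 0 then h else h'" "\<lambda>_. B" "\<lambda>_. -1" "-1"] B h cov
  by (fastforce simp: indicator_def)

section \<open>Absence of mass at the ends of an axis\<close>

text \<open>If powers of two basis elements \<open>a\<close> and \<open>b\<close> commuted with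
  powers of \<open>w\<close>, both would commute with a common power \<open>z\<close> of
  \<open>w\<close>; but the first letter of \<open>z\<close> belongs to at most one of
  \<open>a\<close> and \<open>b\<close>.\<close>

lemma basis_powers_not_all_commute:
  assumes w: "w \<in> F" "w \<noteq> \<one>"
  obtains a where "a \<in> X" "\<And>p n. 1 \<le> p \<Longrightarrow> 1 \<le> n \<Longrightarrow> a [^] (p::nat) \<otimes> w [^] (n::nat) \<noteq> w [^] n \<otimes> a [^] p"
proof -
  obtain a b where ab: "a \<in> X" "b \<in> X" "a \<noteq> b"
    using card_X by (metis card_2_iff' card_le_Suc0_iff_eq finite_X not_less_eq_eq numeral_2_eq_2)
  have step: "c [^] p \<otimes> w [^] (n * m) = w [^] (n * m) \<otimes> c [^] p"
    if "c \<in> X" "c [^] p \<otimes> w [^] n = w [^] n \<otimes> c [^] p" for c and p n m :: nat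
  proof (induction m)
    case (Suc m)
    have split: "w [^] (n * Suc m) = w [^] n \<otimes> w [^] (n * m)" using w by (simp add: nat_pow_mult)
    have "c [^] p \<otimes> w [^] (n * Suc m) = (c [^] p \<otimes> w [^] n) \<otimes> w [^] (n * m)"
      unfolding split using that w by (simp flip: m_assoc)
    also have "\<dots> = w [^] n \<otimes> (c [^] p \<otimes> w [^] (n * m))" using that w by (simp add: m_assoc)
    also have "\<dots> = w [^] (n * Suc m) \<otimes> c [^] p"
      unfolding Suc split using that w by (simp flip: m_assoc)
    finally show ?case .
  qed (use that in simp)
  show thesis
  proof (cases "\<exists>p n. 1 \<le> p \<and> 1 \<le> n \<and> a [^] (p::nat) \<otimes> w [^] (n::nat) = w [^] n \<otimes> a [^] p")
    case False
    then show thesis using that[OF ab(1)] by blast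
  next
    case True
    then obtain p n :: nat where pn: "1 \<le> p" "1 \<le> n" "a [^] p \<otimes> w [^] n = w [^] n \<otimes> a [^] p" by blast
    show thesis
    proof (rule that[OF ab(2)])
      fix q m :: nat assume qm: "1 \<le> q" "1 \<le> m"
      show "b [^] q \<otimes> w [^] m \<noteq> w [^] m \<otimes> b [^] q"
      proof
        assume eq: "b [^] q \<otimes> w [^] m = w [^] m \<otimes> b [^] q"
        define z where "z = w [^] (n * m)"
        have z: "z \<in> F" "z \<noteq> \<one>" using w pow_neq_one[OF w, of "n * m"] pn qm by (auto simp: z_def)
        have "a [^] p \<otimes> z = z \<otimes> a [^] p" "b [^] q \<otimes> z = z \<otimes> b [^] q"
          using step[OF ab(1) pn(3), of m] step[OF ab(2) eq, of n] by (simp_all add: z_def mult.commute)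
        then show False
          using basis_pow_not_commute[OF ab(1) z _ pn(1)] basis_pow_not_commute[OF ab(2) z _ qm(1)] ab(3)
          by metis
      qed
    qed
  qed
qed

text \<open>The stationary mean does not charge the end points \<open>w\<^sup>\<plusminus>\<^sup>\<infinity>\<close>: near its supremum their mass,
  a harmonic function of the starting point, would be almost the same at many disjoint translates.\<close>

lemma near_ends_mass_tendsto_0:
  assumes w: "w \<in> F" "w \<noteq> \<one>"
  shows "(\<lambda>k. f (lift (near_ends w (Suc k))) \<one>) \<longlonglongrightarrow> 0"
proof -
  define D where "D k = lift (near_ends w (Suc k))" for k
  have D: "D k \<in> test_sets" for k using w near_ends_test by (simp add: D_def)
  have "D (Suc k) \<subseteq> D k" for k
    using near_ends_Suc[OF w, of "Suc k"] by (auto simp: D_def lift_def)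
  then have dec: "decseq (\<lambda>k. f (D k) h)" if "h \<in> carrier H" for h
    using that D by (intro decseq_SucI f_mono) auto
  \<comment> \<open>The mass at the two end points themselves, as the decreasing limit over their
    neighbourhoods; it stays harmonic by dominated convergence.\<close>
  define Q where "Q h = (INF k. f (D k) h)" for h
  have Q_lim: "(\<lambda>k. f (D k) h) \<longlonglongrightarrow> Q h" if "h \<in> carrier H" for h
    unfolding Q_def by (rule LIMSEQ_decseq_INF[OF bdd_belowI[of _ 0] dec]) (use that D f_bounds in auto)
  have Q_le: "Q h \<le> f (D k) h" if "h \<in> carrier H" for h k
    by (rule decseq_ge[OF dec Q_lim]) (use that in auto)
  have Q_bounds: "0 \<le> Q h \<and> Q h \<le> 1" if h: "h \<in> carrier H" for h
  proof
    show "0 \<le> Q h" by (rule LIMSEQ_le_const[OF Q_lim[OF h]]) (use f_bounds[OF D h] in auto)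
    show "Q h \<le> 1" using Q_le[OF h, of 0] f_bounds[OF D h, of 0] by simp
  qed
  have Q_harmonic: "harmonic Q"
    unfolding harmonic_def
  proof
    fix h assume h: "h \<in> carrier H"
    have "(\<lambda>k. \<integral>g. f (D k) (h \<otimes> g) \<partial>measure_pmf \<mu>) \<longlonglongrightarrow> (\<integral>g. Q (h \<otimes> g) \<partial>measure_pmf \<mu>)"
      by (rule step_integral_tendsto[of _ 1]) (use f_bounds[OF D] Q_lim h in auto)
    moreover have "(\<integral>g. f (D k) (h \<otimes> g) \<partial>measure_pmf \<mu>) = f (D k) h" for k
      using f_harmonic[OF D] h by (simp add: harmonic_def)
    ultimately show "Q h = (\<integral>g. Q (h \<otimes> g) \<partial>measure_pmf \<mu>)"
      using Q_lim[OF h] LIMSEQ_unique by force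
  qed
  have "Q \<one> = 0"
  proof (rule ccontr)
    assume "Q \<one> \<noteq> 0"
    then have Q1: "0 < Q \<one>" using Q_bounds[of \<one>] by simp
    \<comment> \<open>\<open>N\<close> disjoint translates, each of mass at least
      \<open>Q \<one> / 2\<close>, would exceed total mass one.\<close>
    obtain N :: nat where N: "2 / Q \<one> < real N" using reals_Archimedean2 by blast
    \<comment> \<open>Powers of all basis elements are included, since the suitable \<open>a\<close>
      depends on \<open>h\<close>, which is only found by means of \<open>G\<close>.\<close>
    define G where "G = (\<lambda>(a, j). a [^] j) ` (X \<times> {..<N})"
    have G: "finite G" "G \<subseteq> carrier H" using finite_X by (auto simp: G_def)
    obtain h where h: "h \<in> carrier H" and large: "\<And>g. g \<in> G \<Longrightarrow> Q \<one> / 2 < Q (h \<otimes> g)"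
      using harmonic_almost_max[OF Q_harmonic Q_bounds G one_closed Q1] by blast
    \<comment> \<open>The translates \<open>h \<otimes> a [^] j\<close> differ by conjugates of
      powers of \<open>a\<close> by \<open>h\<close>. Undoing this conjugation replaces
      \<open>w\<close> by \<open>w'\<close>, so \<open>a\<close> is chosen with respect to
      \<open>w'\<close>.\<close>
    define w' where "w' = inv h \<otimes> w \<otimes> h"
    have w': "w' \<in> F" using conjugate_F[of "inv h" w] h w by (simp add: w'_def)
    have hw': "h \<otimes> w' = w \<otimes> h" using h w by (simp add: w'_def m_assoc inv_mult_cancel)
    have "w' \<noteq> \<one>"
    proof
      assume "w' = \<one>"
      then have "h = w \<otimes> h" using hw' h by simp
      then show False using w h by (metis F_closed r_cancel_one')
    qed
    then obtain a where a: "a \<in> X"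
      and nc: "\<And>p n. 1 \<le> p \<Longrightarrow> 1 \<le> n \<Longrightarrow> a [^] (p::nat) \<otimes> w' [^] (n::nat) \<noteq> w' [^] n \<otimes> a [^] p"
      using basis_powers_not_all_commute[OF w'] by blast
    define x where "x p = h \<otimes> a [^] (p::nat) \<otimes> inv h" for p
    have xF: "x p \<in> F" for p using conjugate_F h a by (simp add: x_def)
    have hpow: "h \<otimes> w' [^] n = w [^] n \<otimes> h" for n :: nat
    proof (induction n)
      case (Suc n)
      have "h \<otimes> w' [^] Suc n = (h \<otimes> w' [^] n) \<otimes> w'" using h w' by (simp add: m_assoc)
      also have "\<dots> = w [^] n \<otimes> (h \<otimes> w')" unfolding Suc using h w w' by (simp add: m_assoc)
      also have "\<dots> = w [^] Suc n \<otimes> h" unfolding hw' using h w by (simp add: m_assoc)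
      finally show ?case .
    qed (use h in simp)
    have fin: "finite {k. \<exists>z\<in>near_ends w k. x p \<otimes> z \<in> near_ends w k}" if p: "1 \<le> p" for p
    proof (rule ccontr)
      assume "infinite {k. \<exists>z\<in>near_ends w k. x p \<otimes> z \<in> near_ends w k}"
      then obtain n :: nat where n: "1 \<le> n"
        "x p \<otimes> w [^] n = w [^] n \<otimes> x p \<or> x p \<otimes> w [^] n = inv (w [^] n) \<otimes> x p"
        using near_ends_overlap[OF w xF] by blast
      have wn: "w [^] n = h \<otimes> w' [^] n \<otimes> inv h" using h w w' by (simp add: hpow m_assoc)
      have iwn: "inv (w [^] n) = h \<otimes> inv (w' [^] n) \<otimes> inv h"
        unfolding wn using h w' by (simp add: inv_mult_group m_assoc)
      have l: "x p \<otimes> w [^] n = h \<otimes> (a [^] p \<otimes> w' [^] n) \<otimes> inv h"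
        unfolding wn x_def using h w' a by (simp add: m_assoc inv_mult_cancel)
      have r1: "w [^] n \<otimes> x p = h \<otimes> (w' [^] n \<otimes> a [^] p) \<otimes> inv h"
        unfolding wn x_def using h w' a by (simp add: m_assoc inv_mult_cancel)
      have r2: "inv (w [^] n) \<otimes> x p = h \<otimes> (inv (w' [^] n) \<otimes> a [^] p) \<otimes> inv h"
        unfolding iwn x_def using h w' a by (simp add: m_assoc inv_mult_cancel)
      \<comment> \<open>The choice of \<open>a\<close> excludes commutation, so
        \<open>a [^] p\<close> inverts \<open>w' [^] n\<close>; then its square commutes with it,
        which is excluded too.\<close>
      have "a [^] p \<otimes> w' [^] n = inv (w' [^] n) \<otimes> a [^] p"
        using n(2) nc[OF p n(1)] unfolding l r1 r2 using h w' a by simp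
      moreover have "a [^] (2 * p) = a [^] p \<otimes> a [^] p" using a by (simp add: nat_pow_mult mult_2)
      ultimately have "a [^] (2 * p) \<otimes> w' [^] n = w' [^] n \<otimes> a [^] (2 * p)"
        using a w' inv_mult_cancel
        by (metis F_closed F_pow X_F F_inv inv_solve_left m_assoc m_closed)
      then show False using nc[of "2 * p" n] p n(1) by simp
    qed
    \<comment> \<open>Past the finitely many depths at which some difference \<open>p < N\<close>
      makes the neighbourhood meet its translate, all \<open>N\<close> translates are
      disjoint.\<close>
    have "finite (\<Union>p\<in>{1..<N}. {k. \<exists>z\<in>near_ends w k. x p \<otimes> z \<in> near_ends w k})" (is "finite ?K")
      using fin by auto
    then have "\<exists>k. \<forall>m\<in>?K. m \<le> k" by (simp only: finite_nat_set_iff_bounded_le)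
    then obtain k where k: "\<forall>m\<in>?K. m \<le> k" ..
    have kK: "Suc k \<notin> ?K"
    proof
      assume "Suc k \<in> ?K"
      with k have "Suc k \<le> k" by (rule bspec)
      then show False by simp
    qed
    have "(\<Sum>j<N. f (D k) (h \<otimes> a [^] j)) \<le> 1"
    proof (rule f_packing[OF D])
      fix g i j assume g: "g \<in> carrier H" and ij: "i < j" "j < N"
        and in_D: "h \<otimes> a [^] i \<otimes> g \<in> D k" "h \<otimes> a [^] j \<otimes> g \<in> D k"
      have aj: "a [^] j = a [^] (j - i) \<otimes> a [^] i" using ij a by (simp add: nat_pow_mult)
      have "h \<otimes> a [^] j \<otimes> g = x (j - i) \<otimes> (h \<otimes> a [^] i \<otimes> g)"
        unfolding aj x_def using h a g by (simp add: m_assoc inv_mult_cancel)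
      then have "proj (h \<otimes> a [^] j \<otimes> g) = x (j - i) \<otimes> proj (h \<otimes> a [^] i \<otimes> g)"
        using xF h a g by (simp add: proj_mult)
      then have "Suc k \<in> ?K" using in_D ij
        by (intro UN_I[of "j - i"]) (auto simp: D_def lift_def)
      then show False using kK by blast
    qed (use h a in auto)
    moreover have "(\<Sum>j<N. Q \<one> / 2) \<le> (\<Sum>j<N. f (D k) (h \<otimes> a [^] j))"
    proof (rule sum_mono)
      fix j assume "j \<in> {..<N}"
      then have "a [^] j \<in> G" using a by (auto simp: G_def)
      then show "Q \<one> / 2 \<le> f (D k) (h \<otimes> a [^] j)"
        using large[of "a [^] j"] Q_le[of "h \<otimes> a [^] j" k] h a by simp
    qed
    ultimately have "real N * (Q \<one> / 2) \<le> 1" by simp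
    then show False using N Q1 by (simp add: field_simps)
  qed
  then show ?thesis using Q_lim[of \<one>] by (simp add: D_def)
qed

section \<open>From asymptotic invariance to convergence of one path\<close>

text \<open>The deterministic part of the argument: the hypotheses on \<open>\<tau>\<close> collect
  what is known almost surely.\<close>

lemma convergence_of_good_path:
  assumes \<tau>: "\<And>i. \<tau> i \<in> carrier H"
    and incr: "\<And>B. B \<in> test_sets \<Longrightarrow> (\<lambda>i. f B (\<tau> (Suc i)) - f B (\<tau> i)) \<longlonglongrightarrow> 0"
    and trans: "\<And>B g. B \<in> test_sets \<Longrightarrow> g \<in> carrier H \<Longrightarrow> (\<lambda>i. f B (\<tau> i \<otimes> g) - f B (\<tau> i)) \<longlonglongrightarrow> 0"
    and small: "\<And>w. w \<in> F \<Longrightarrow> w \<noteq> \<one> \<Longrightarrow> \<exists>k. \<forall>i. f (lift (near_ends w (Suc k))) (\<tau> i) < 1 / 4"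
  shows "\<exists>w\<in>hyp_boundary X.
    limitin (hyp_topology X) (\<lambda>i. Fin_word (reduced_form H X (proj (\<tau> i)))) w sequentially"
proof (rule limitin_hyp_boundary)
  show "proj (\<tau> i) \<in> F" for i using \<tau> by simp
  define W where "W i = conj_u (\<tau> i)" for i
  have WF: "W i \<in> F" and W1: "W i \<noteq> \<one>" for i using \<tau> by (simp_all add: W_def conj_u_neq_one)
  have ev_abs: "\<forall>\<^sub>F i in sequentially. \<bar>s i\<bar> < e" if "s \<longlonglongrightarrow> 0" "0 < e" for s :: "nat \<Rightarrow> real" and e
    using tendstoD[OF that] by (simp add: dist_real_def)
  have finite_visits: "finite {i. W i = w}" for w
  proof (rule ccontr)
    assume inf: "infinite {i. W i = w}"
    then obtain i0 where "W i0 = w" using not_finite_existsD by auto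
    then have w: "w \<in> F" "w \<noteq> \<one>" using WF W1 by auto
    obtain k where k: "\<And>i. f (lift (near_ends w (Suc k))) (\<tau> i) < 1 / 4" using small[OF w] by blast
    define B where "B = lift (near_ends w (Suc k))"
    define g where "g = u [^] (2 * Suc k)"
    have B: "B \<in> test_sets" using near_ends_test w by (simp add: B_def)
    have "\<forall>\<^sub>F i in sequentially. \<bar>f B (\<tau> i \<otimes> g) - f B (\<tau> i)\<bar> < 1 / 4"
      by (rule ev_abs[OF trans[OF B]]) (simp_all add: g_def)
    then obtain n where n: "\<And>i. n \<le> i \<Longrightarrow> \<bar>f B (\<tau> i \<otimes> g) - f B (\<tau> i)\<bar> < 1 / 4"
      by (auto simp: eventually_sequentially)
    obtain i where i: "n \<le> i" "W i = w" using inf by (auto simp: infinite_nat_iff_unbounded_le)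
    \<comment> \<open>When \<open>W i = w\<close>, translation by \<open>g\<close> acts as
      \<open>w [^] (2 * Suc k)\<close>, so each point or its image is near an end of
      \<open>w\<close>. But the two masses are below \<open>1 / 4\<close> and
      \<open>1 / 2\<close>.\<close>
    have "1 \<le> f B (\<tau> i) + f B (\<tau> i \<otimes> g)"
    proof (rule f_covering2[OF B])
      fix g' assume g': "g' \<in> carrier H"
      have "proj (\<tau> i \<otimes> g \<otimes> g') = w [^] (2 * Suc k) \<otimes> proj (\<tau> i \<otimes> g')"
        unfolding g_def using proj_translate[OF \<tau> g', of i "2 * Suc k"] i(2) by (simp only: W_def)
      then show "\<tau> i \<otimes> g' \<in> B \<or> \<tau> i \<otimes> g \<otimes> g' \<in> B"
        using pow_moves_into_near_ends[OF w, of "Suc k" "proj (\<tau> i \<otimes> g')"] \<tau> g'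
        by (auto simp: B_def lift_def g_def simp del: mult_Suc_right nat_pow_Suc)
    qed (use \<tau> in \<open>auto simp: g_def\<close>)
    then show False using n[OF i(1)] k[of i] by (simp add: B_def)
  qed
  have W_inf: "\<forall>\<^sub>F i in sequentially. n < len (W i)" for n
  proof -
    have "{i. \<not> n < len (W i)} \<subseteq> (\<Union>w\<in>{w \<in> F. len w \<le> n}. {i. W i = w})" using WF by auto
    then have "finite {i. \<not> n < len (W i)}"
      using finite_len_le finite_visits by (meson finite_UN_I finite_subset)
    then show ?thesis by (simp add: eventually_cofinite flip: cofinite_eq_sequentially)
  qed
  \<comment> \<open>Conjugates of \<open>u\<close> have bounded translation length, so the growth of
    \<open>W i\<close> comes from the distance of its axis.\<close>
  have axis_inf: "\<forall>\<^sub>F i in sequentially. n \<le> axis_dist (W i)" for n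
    using W_inf[of "2 * n + translation_length u"]
  proof eventually_elim
    case (elim i)
    have "translation_length (W i) \<le> translation_length u"
      using translation_length_conjugate_le[OF u_F u_neq_one, of "proj (\<tau> i)"] \<tau>
      by (simp add: W_def conj_u_proj)
    then show ?case using elim len_axis[OF WF, of i] by simp
  qed
  fix n
  define V where "V = {v. set v \<subseteq> X \<times> (UNIV :: bool set) \<and> length v \<le> n}"
  define B where "B v = lift (cyl n v)" for v
  define t where "t i = take n (rf (W i))" for i
  have V: "finite V" unfolding V_def by (rule finite_lists_length_le) (use finite_X in simp)
  have take_V: "take n (rf x) \<in> V" if "x \<in> F" for x
    using rf_letters[OF that] by (force simp: V_def dest: in_set_takeD)
  have B: "B v \<in> test_sets" if "v \<in> V" for v
    unfolding B_def by (rule cyl_test) (use that in \<open>auto simp: V_def in_lists_conv_set\<close>)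
  \<comment> \<open>Chosen so that all cylinders other than that of \<open>t i\<close> carry at most
    \<open>1 / 4\<close> together.\<close>
  define \<delta> where "\<delta> = 1 / (4 * real (card V))"
  have "[] \<in> V" by (simp add: V_def)
  then have cV: "1 \<le> card V" using V by (metis card_0_eq empty_iff less_one not_le)
  then have \<delta>: "0 < \<delta>" "\<delta> \<le> 1 / 4" "real (card V) * \<delta> = 1 / 4" by (auto simp: \<delta>_def field_simps)
  \<comment> \<open>Words with a prefix \<open>v\<close> other than \<open>t i\<close> branch off
    before the axis of \<open>W i\<close>, and positive powers of \<open>W i\<close> move them to
    words that follow \<open>W i\<close>. The \<open>Suc K\<close> translates are therefore disjoint
    and of nearly equal mass, which is at most
    \<open>1 / Suc K + \<delta> / 2 < \<delta>\<close>.\<close>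
  have off: "\<forall>\<^sub>F i in sequentially. \<forall>v\<in>V. v \<noteq> t i \<longrightarrow> f (B v) (\<tau> i) < \<delta>"
  proof -
    obtain K where K: "inverse (real (Suc K)) < \<delta> / 2" using reals_Archimedean[of "\<delta> / 2"] \<delta> by auto
    have "\<forall>\<^sub>F i in sequentially. \<forall>v\<in>V. \<forall>k\<in>{..<Suc K}. \<bar>f (B v) (\<tau> i \<otimes> u [^] k) - f (B v) (\<tau> i)\<bar> < \<delta> / 2"
      by (intro eventually_ball_finite ballI ev_abs trans B V) (use \<delta> in auto)
    with axis_inf[of n] show ?thesis
    proof eventually_elim
      case (elim i)
      show ?case
      proof (intro ballI impI)
        fix v assume v: "v \<in> V" "v \<noteq> t i"
        have C: "cp y (W i) < axis_dist (W i) \<and> cp y (W i) < n" if "y \<in> cyl n v" for y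
        proof -
          have "\<not> n \<le> cp y (W i)" using that v by (auto simp: le_cp_iff cyl_def t_def)
          then show ?thesis using elim(1) by simp
        qed
        have "(\<Sum>k<Suc K. f (B v) (\<tau> i \<otimes> u [^] k)) \<le> 1"
        proof (rule f_packing[OF B[OF v(1)]])
          fix g and k l :: nat assume g: "g \<in> carrier H" and kl: "k < l"
            and in_B: "\<tau> i \<otimes> u [^] k \<otimes> g \<in> B v" "\<tau> i \<otimes> u [^] l \<otimes> g \<in> B v"
          have ul: "u [^] l = u [^] (l - k) \<otimes> u [^] k" using kl by (simp add: nat_pow_mult)
          define y where "y = proj (\<tau> i \<otimes> u [^] k \<otimes> g)"
          have y: "y \<in> cyl n v" using in_B by (simp add: y_def B_def lift_def)
          have "\<tau> i \<otimes> u [^] l \<otimes> g = \<tau> i \<otimes> u [^] (l - k) \<otimes> (u [^] k \<otimes> g)"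
            unfolding ul using \<tau> g by (simp add: m_assoc)
          then have "proj (\<tau> i \<otimes> u [^] l \<otimes> g) = W i [^] (l - k) \<otimes> proj (\<tau> i \<otimes> (u [^] k \<otimes> g))"
            using proj_translate[of "\<tau> i" "u [^] k \<otimes> g" "l - k"] \<tau> g by (simp add: W_def)
          then have "W i [^] (l - k) \<otimes> y \<in> cyl n v"
            using in_B \<tau> g by (simp add: y_def B_def lift_def m_assoc)
          moreover have "axis_dist (W i) \<le> cp (W i [^] (l - k) \<otimes> y) (W i)"
            by (rule pow_attracts[OF WF W1]) (use y C kl in \<open>auto simp: cyl_def\<close>)
          ultimately show False using C by fastforce
        qed (use \<tau> in auto)
        moreover have "(\<Sum>k<Suc K. f (B v) (\<tau> i) - \<delta> / 2) \<le> (\<Sum>k<Suc K. f (B v) (\<tau> i \<otimes> u [^] k))"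
        proof (rule sum_mono)
          fix k assume "k \<in> {..<Suc K}"
          then have "\<bar>f (B v) (\<tau> i \<otimes> u [^] k) - f (B v) (\<tau> i)\<bar> < \<delta> / 2"
            using elim(2) v by blast
          then show "f (B v) (\<tau> i) - \<delta> / 2 \<le> f (B v) (\<tau> i \<otimes> u [^] k)" by linarith
        qed
        ultimately have "real (Suc K) * (f (B v) (\<tau> i) - \<delta> / 2) \<le> 1" by simp
        then have "f (B v) (\<tau> i) - \<delta> / 2 \<le> inverse (real (Suc K))"
          by (simp add: inverse_eq_divide pos_le_divide_eq mult.commute del: of_nat_Suc)
        then show "f (B v) (\<tau> i) < \<delta>" using K by simp
      qed
    qed
  qed
  have on: "\<forall>\<^sub>F i in sequentially. 3 / 4 \<le> f (B (t i)) (\<tau> i)"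
    using off
  proof eventually_elim
    case (elim i)
    have tV: "t i \<in> V" using take_V[OF WF] by (simp add: t_def)
    have "1 \<le> (\<Sum>v\<in>V. f (B v) (\<tau> i))"
    proof (rule f_covering[OF V B \<tau>])
      fix g assume g: "g \<in> carrier H"
      have "\<tau> i \<otimes> g \<in> B (take n (rf (proj (\<tau> i \<otimes> g))))" using g \<tau> by (simp add: B_def lift_def cyl_def)
      then show "\<exists>v\<in>V. \<tau> i \<otimes> g \<in> B v" using take_V[of "proj (\<tau> i \<otimes> g)"] g \<tau> by auto
    qed
    also have "(\<Sum>v\<in>V. f (B v) (\<tau> i)) = f (B (t i)) (\<tau> i) + (\<Sum>v\<in>V - {t i}. f (B v) (\<tau> i))"
      by (rule sum.remove[OF V tV])
    also have "(\<Sum>v\<in>V - {t i}. f (B v) (\<tau> i)) \<le> (\<Sum>v\<in>V - {t i}. \<delta>)"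
      by (rule sum_mono) (use elim in force)
    also have "\<dots> \<le> real (card V) * \<delta>" using V \<delta> by (simp add: mult_right_mono card_Diff1_le)
    finally show ?case using \<delta> by simp
  qed
  have "\<forall>\<^sub>F i in sequentially. \<forall>v\<in>V. \<bar>f (B v) (\<tau> (Suc i)) - f (B v) (\<tau> i)\<bar> < 1 / 4"
    by (intro eventually_ball_finite ballI ev_abs incr B V) auto
  \<comment> \<open>If \<open>t\<close> changed, the mass of the old cylinder would fall from at
    least \<open>3 / 4\<close> to below \<open>1 / 4\<close> in one step, while increments are below
    \<open>1 / 4\<close>.\<close>
  then have "\<forall>\<^sub>F i in sequentially. t (Suc i) = t i"
    using on eventually_compose_filterlim[OF off filterlim_Suc]
  proof eventually_elim
    case (elim i)
    have tV: "t i \<in> V" using take_V[OF WF] by (simp add: t_def)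
    show ?case
    proof (rule ccontr)
      assume "t (Suc i) \<noteq> t i"
      then have "f (B (t i)) (\<tau> (Suc i)) < \<delta>" using elim(3) tV by metis
      then show False using elim(1)[rule_format, OF tV] elim(2) \<delta> by simp
    qed
  qed
  then obtain i0 where i0: "\<And>i. i0 \<le> i \<Longrightarrow> t (Suc i) = t i" by (auto simp: eventually_sequentially)
  have t_const: "t i = t i0" if "i0 \<le> i" for i
    using that by (induction rule: dec_induct) (simp_all add: i0)
  \<comment> \<open>The threshold \<open>len u + 2 * n\<close> makes \<open>proj (\<tau> i)\<close>
    share its first \<open>n\<close> letters with \<open>W i\<close>.\<close>
  have "\<forall>\<^sub>F i in sequentially. n \<le> len (proj (\<tau> i)) \<and> take n (rf (proj (\<tau> i))) = t i0"
    using eventually_ge_at_top[of i0] W_inf[of "len u + 2 * n"]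
  proof eventually_elim
    case (elim i)
    have "len (W i) \<le> len u + 2 * cp (proj (\<tau> i)) (W i)"
      using len_conjugate_le[of "proj (\<tau> i)" u] \<tau> u_F by (simp add: W_def conj_u_proj)
    then have "n \<le> cp (proj (\<tau> i)) (W i)" using elim by simp
    then show ?case using t_const[OF elim(1)] by (simp add: le_cp_iff t_def)
  qed
  then show "\<exists>v. \<forall>\<^sub>F i in sequentially. n \<le> len (proj (\<tau> i)) \<and> take n (rf (proj (\<tau> i))) = v" by blast
qed

section \<open>Almost sure convergence\<close>

text \<open>Test sets, group elements and elements of \<open>F\<close> are countable in number, so
  each hypothesis on a good path fails only on one null set.\<close>

lemma AE_convergence_aux:
  "AE \<tau> in P. \<exists>w\<in>hyp_boundary X.
    limitin (hyp_topology X) (\<lambda>i. Fin_word (reduced_form H X (proj (\<tau> i)))) w sequentially"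
proof -
  have "AE \<tau> in P. \<forall>B\<in>test_sets. (\<lambda>i. f B (\<tau> (Suc i)) - f B (\<tau> i)) \<longlonglongrightarrow> 0"
    using f_harmonic f_bounds
    by (intro AE_ball_countable'[OF _ countable_test_sets] AE_increment_tendsto_0) auto
  moreover have "AE \<tau> in P. \<forall>B\<in>test_sets. \<forall>g\<in>carrier H. (\<lambda>i. f B (\<tau> i \<otimes> g) - f B (\<tau> i)) \<longlonglongrightarrow> 0"
    using f_harmonic f_bounds countable_test_sets countable_carrier
    by (intro AE_ball_countable' AE_translate_tendsto_0) auto
  moreover have "AE \<tau> in P. \<forall>w\<in>F - {\<one>}. \<exists>k. \<forall>i. f (lift (near_ends w (Suc k))) (\<tau> i) < 1 / 4"
  proof (rule AE_ball_countable')
    fix w assume w: "w \<in> F - {\<one>}"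
    show "AE \<tau> in P. \<exists>k. \<forall>i. f (lift (near_ends w (Suc k))) (\<tau> i) < 1 / 4"
      by (rule AE_stays_small)
         (use w near_ends_mass_tendsto_0 f_harmonic f_bounds near_ends_test in auto)
  qed (use countable_F in auto)
  moreover have "AE \<tau> in P. \<tau> \<in> space P" by (rule AE_space)
  ultimately show ?thesis
  proof eventually_elim
    case (elim \<tau>)
    show ?case by (rule convergence_of_good_path) (use elim in auto)
  qed
qed

end

lemma AE_convergence:
  "AE \<tau> in P. \<exists>w\<in>hyp_boundary X.
    limitin (hyp_topology X) (\<lambda>i. Fin_word (reduced_form H X (proj (\<tau> i)))) w sequentially"
proof (rule stationary_mean_exists[OF countable_test_sets])
  fix f :: "'a set \<Rightarrow> 'a \<Rightarrow> real"
  assume f: "\<And>B. B \<in> test_sets \<Longrightarrow> harmonic (f B)"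
    "\<And>I h B c b. finite I \<Longrightarrow> (\<And>i::nat. i \<in> I \<Longrightarrow> h i \<in> carrier H) \<Longrightarrow> (\<And>i. i \<in> I \<Longrightarrow> B i \<in> test_sets) \<Longrightarrow>
      (\<And>g. g \<in> carrier H \<Longrightarrow> (\<Sum>i\<in>I. c i * indicator (B i) (h i \<otimes> g)) \<le> (b::real)) \<Longrightarrow>
      (\<Sum>i\<in>I. c i * f (B i) (h i)) \<le> b"
  show ?thesis
  proof (rule AE_convergence_aux[of f])
    fix I :: "nat set" and h B and c :: "nat \<Rightarrow> real" and b
    assume "finite I" "\<And>i. i \<in> I \<Longrightarrow> h i \<in> carrier H" "\<And>i. i \<in> I \<Longrightarrow> B i \<in> test_sets"
      "\<And>g. g \<in> carrier H \<Longrightarrow> (\<Sum>i\<in>I. c i * indicator (B i) (h i \<otimes> g)) \<le> b"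
    then show "(\<Sum>i\<in>I. c i * f (B i) (h i)) \<le> b" by (rule f(2))
  qed (rule f(1))
qed

end

text \<open>As \<open>F\<close> and \<open>A\<close> meet only in the identity, \<open>x\<close> and
  \<open>\<alpha>\<close> are determined by the path, so quantifying them existentially loses
  nothing.\<close>

theorem theorem2:
  fixes H :: "('a, 'b) monoid_scheme" and F A X :: "'a set"
    and \<mu> :: "'a pmf" and P :: "(nat \<Rightarrow> 'a) measure"
  assumes "group H" and "countable (carrier H)"
    and "inner_semidirect H F A"
    and "free_basis H F X" and "finite X" and "2 \<le> card X"
    and "\<exists>u\<in>F. u \<noteq> \<one>\<^bsub>H\<^esub> \<and> (\<forall>a\<in>A. a \<otimes>\<^bsub>H\<^esub> u \<otimes>\<^bsub>H\<^esub> inv\<^bsub>H\<^esub> a = u)"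
    and "nondegenerate H \<mu>"
    and "walk_measure H \<mu> P"
  shows "AE \<tau> in P. \<exists>x \<alpha> w.
           (\<forall>i. x i \<in> F \<and> \<alpha> i \<in> A \<and> \<tau> i = x i \<otimes>\<^bsub>H\<^esub> \<alpha> i) \<and>
           w \<in> hyp_boundary X \<and>
           limitin (hyp_topology X) (\<lambda>i. Fin_word (reduced_form H X (x i))) w sequentially"
proof -
  obtain u where u: "u \<in> F" "u \<noteq> \<one>\<^bsub>H\<^esub>" "\<forall>a\<in>A. a \<otimes>\<^bsub>H\<^esub> u \<otimes>\<^bsub>H\<^esub> inv\<^bsub>H\<^esub> a = u"
    using assms(7) by blast
  interpret group H by fact
  interpret semidirect_walk H F X \<mu> P A u
    by (intro semidirect_walk.intro free_subgroup.intro free_subgroup_axioms.intro random_walk.intro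
        group_walk.intro group_walk_axioms.intro random_walk_axioms.intro semidirect_walk_axioms.intro)
       (use assms u normal_imp_subgroup in \<open>auto simp: inner_semidirect_def\<close>)
  have "AE \<tau> in P. \<tau> \<in> space P" by (rule AE_space)
  with AE_convergence show ?thesis
  proof eventually_elim
    case (elim \<tau>)
    then obtain w where w: "w \<in> hyp_boundary X"
      "limitin (hyp_topology X) (\<lambda>i. Fin_word (reduced_form H X (proj (\<tau> i)))) w sequentially" by blast
    have "\<exists>a. a \<in> A \<and> \<tau> i = proj (\<tau> i) \<otimes>\<^bsub>H\<^esub> a" for i
      using proj_decomp[OF path_closed[OF elim(2)], of i] by metis
    then obtain \<alpha> where "\<And>i. \<alpha> i \<in> A \<and> \<tau> i = proj (\<tau> i) \<otimes>\<^bsub>H\<^esub> \<alpha> i" by metis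
    then show ?case using w elim(2) by (intro exI[of _ "\<lambda>i. proj (\<tau> i)"] exI[of _ \<alpha>] exI[of _ w]) auto
  qed
qed

end
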